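(* Let $\mu$ be an even probability measure on $\mathbb{R}$ with finite absolute fifth moment and density $e^{-V}$, where $V\in C^2(\mathbb{R})$. Then the following are equivalent: (1) there exist $a,b>0$ such that for all Borel measurable $f,g:\mathbb{R}\to[0,1]$, $$\int_{\mathbb{R}}\operatorname*{ess\,sup}_{y\in\mathbb{R}}H\left(f\left(\tfrac{x-y}{a}\right),g\left(\tfrac{y}{b}\right)\right)d\mu(x)\ \ge\ H\left(\int_{\mathbb{R}} f\,d\mu,\int_{\mathbb{R}} g\,d\mu\right),$$ where $H(x,y)=\Phi(a\Phi^{-1}(x)+b\Phi^{-1}(y))$ on $[0,1]^2\setminus\{(0,1),(1,0)\}$, $H(0,1)=H(1,0)=0$, and $\Phi(s)=\int_{-\infty}^s d\mu$; (2) $\mu$ is a Gaussian measure.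
   Context: The essential supremum is with respect to Lebesgue measure. Conventions: $\Phi^{-1}(0)=-\infty$, $\Phi^{-1}(1)=+\infty$, $\Phi(-\infty)=0$, $\Phi(+\infty)=1$. A Gaussian measure on $\mathbb{R}$ is a probability measure of the form $e^{-\alpha x^2+\beta x+c}\,dx$ with $\alpha>0$, $\beta,c\in\mathbb{R}$. *)

theory Defs
  imports "HOL-Probability.Probability"
begin

definition C2 :: "(real \<Rightarrow> real) \<Rightarrow> bool" where
  "C2 V \<longleftrightarrow> (\<exists>V' V''.
     (\<forall>x. (V has_real_derivative V' x) (at x)) \<and>
     (\<forall>x. (V' has_real_derivative V'' x) (at x)) \<and>
     continuous_on UNIV V'')"

definition even_measure :: "real measure \<Rightarrow> bool" where
  "even_measure \<mu> \<longleftrightarrow> distr \<mu> borel uminus = \<mu>"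

definition gaussian_measure :: "real measure \<Rightarrow> bool" where
  "gaussian_measure \<mu> \<longleftrightarrow> prob_space \<mu> \<and>
     (\<exists>\<alpha> \<beta> c. \<alpha> > 0 \<and>
        \<mu> = density lborel (\<lambda>x. ennreal (exp (- \<alpha> * x\<^sup>2 + \<beta> * x + c))))"

definition Phi :: "real measure \<Rightarrow> ereal \<Rightarrow> real" where
  "Phi \<mu> s = (case s of ereal r \<Rightarrow> cdf \<mu> r | PInfty \<Rightarrow> 1 | MInfty \<Rightarrow> 0)"

text \<open>The inverse of the distribution function is meant for arguments in \<open>[0,1]\<close> and for
  measures whose distribution function is a bijection from the real line onto \<open>(0,1)\<close>, such as
  those with a continuous, everywhere positive density.\<close>

definition Phi_inv :: "real measure \<Rightarrow> real \<Rightarrow> ereal" where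
  "Phi_inv \<mu> p = (if p = 0 then - \<infinity> else if p = 1 then \<infinity> else ereal (the_inv (cdf \<mu>) p))"

text \<open>For \<open>a, b > 0\<close>, the undetermined sum of opposite infinities could occur only at the
  two corners that are treated separately.\<close>

definition H :: "real measure \<Rightarrow> real \<Rightarrow> real \<Rightarrow> real \<Rightarrow> real \<Rightarrow> real" where
  "H \<mu> a b x y =
     (if (x, y) = (0, 1) \<or> (x, y) = (1, 0) then 0
      else Phi \<mu> (ereal a * Phi_inv \<mu> x + ereal b * Phi_inv \<mu> y))"

end

theory Submission
  imports Defs
begin


text \<open>
Write \<open>\<Phi>\<close> for the distribution function of \<open>\<mu>\<close> and \<open>\<phi> = exp (- V)\<close> for its density.

\<^bold>\<open>The inequality forces a Gaussian.\<close> Apply it to \<open>f x = \<Phi> (u + \<epsilon> x)\<close> and \<open>g x = \<Phi> (v + \<epsilon> x)\<close>. In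
\<open>a (u + \<epsilon> (x - y) / a) + b (v + \<epsilon> y / b) = a u + b v + \<epsilon> x\<close> the variable \<open>y\<close> cancels, so the essential
supremum is harmless and, with \<open>A u \<epsilon> = \<Phi>\<^sup>-\<^sup>1 (\<integral> \<Phi> (u + \<epsilon> x) d\<mu>)\<close>, the inequality reads
\<open>a A u \<epsilon> + b A v \<epsilon> \<le> A (a u + b v) \<epsilon>\<close>. The mean of \<open>\<mu>\<close> vanishes because \<open>\<mu>\<close> is even, hence
\<open>A u \<epsilon> = u - \<epsilon>\<^sup>2 V' u m / 2 + o (\<epsilon>\<^sup>2)\<close> with \<open>m\<close> the second moment (\<open>linear_perturbation_limit\<close>), and
comparing the second order terms gives \<open>V' (a u + b v) \<le> a V' u + b V' v\<close>. Since \<open>V'\<close> is odd,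
replacing \<open>(u, v)\<close> by \<open>(- u, - v)\<close> turns this into an equality. So \<open>V'\<close> is additive, \<open>V''\<close> is
constant and \<open>V\<close> is a quadratic polynomial (\<open>gaussian_of_functional_inequality\<close>).

\<^bold>\<open>A Gaussian satisfies the inequality.\<close> An even Gaussian has a density
\<open>exp (c - \<alpha> x\<^sup>2)\<close>, and \<open>a = b = 1\<close> works. This is an Ehrhard inequality: if
\<open>u x + v y \<le> r (x + y)\<close> for all \<open>x\<close> and \<open>y\<close>, then
\<open>\<Phi>\<^sup>-\<^sup>1 (\<integral> \<Phi> u) + \<Phi>\<^sup>-\<^sup>1 (\<integral> \<Phi> v) \<le> \<Phi>\<^sup>-\<^sup>1 (\<integral> \<Phi> r)\<close>. Following Borell, transport a profile \<open>w\<close> by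
\<open>W s x = \<Phi>\<^sup>-\<^sup>1 (\<integral> \<Phi> (w (x + s z)) d\<mu> z)\<close>, which equals \<open>w\<close> at \<open>s = 0\<close> and the quantity of interest at
\<open>s = 1\<close>, \<open>x = 0\<close>. The heat equation for the mean becomes
\<open>\<partial>\<^sub>s W = s / (2 \<alpha>) (\<partial>\<^sub>x\<^sub>x W - 2 \<alpha> W (\<partial>\<^sub>x W)\<^sup>2)\<close> (\<open>ehrhard_flow_exists\<close>). At a point where
\<open>D = R s (x + y) - U s x - V s y\<close> has a negative spatial minimum, the three slopes have a common
value \<open>k\<close>; the second derivatives of \<open>D\<close> along \<open>(1, 0)\<close>, \<open>(0, 1)\<close> and \<open>(1, -1)\<close> are nonnegative
and add up to \<open>2 (R'' - U'' - V'')\<close>; and the first order terms contribute \<open>- s D k\<^sup>2 \<ge> 0\<close>. So \<open>D\<close>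
cannot become negative (\<open>ehrhard_flow_comparison\<close>). The choice \<open>a = b = 1\<close> is what makes these
three directions suffice.

The flow needs twice differentiable profiles with bounded derivatives. The relation
\<open>u x + v y \<le> r (x + y)\<close> is additive in the profiles and survives averaging \<open>u\<close> and \<open>r\<close> over the same
window, even if it is only known for almost every \<open>y\<close>. Each average gains one derivative, and by
Lebesgue differentiation it can be undone in the limit. This extends the inequality to all bounded
Borel profiles (\<open>ehrhard_ineq_bounded_borel\<close>). Functions \<open>f\<close>, \<open>g\<close> with values in \<open>[0, 1]\<close> are
truncated away from \<open>0\<close> and \<open>1\<close> to obtain bounded profiles, and the truncation is removed at the end
(\<open>functional_ehrhard\<close>).
\<close>

section \<open>The distribution function of a positive continuous density\<close>

text \<open>
Positivity makes the distribution function a bijection onto the open unit interval with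
differentiable inverse, and continuity makes the density its pointwise derivative.
\<close>

locale positive_density =
  fixes \<mu> :: "real measure" and \<phi> :: "real \<Rightarrow> real"
  assumes prob: "prob_space \<mu>"
    and density: "\<mu> = density lborel (\<lambda>x. ennreal (\<phi> x))"
    and pos: "\<phi> x > 0"
    and cont: "continuous_on UNIV \<phi>"
begin

sublocale prob_space \<mu> by (rule prob)

lemma sets_mu [simp, measurable_cong]: "sets \<mu> = sets borel"
  and space_mu [simp]: "space \<mu> = UNIV"
  by (simp_all add: density)

sublocale real_distribution \<mu>
  by unfold_locales auto

lemma borel_phi [measurable]: "\<phi> \<in> borel_measurable borel"
  by (rule borel_measurable_continuous_onI[OF cont])

lemma integral_mu:
  fixes f :: "real \<Rightarrow> real"
  assumes "f \<in> borel_measurable borel"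
  shows "(\<integral>x. f x \<partial>\<mu>) = (\<integral>x. \<phi> x * f x \<partial>lborel)"
  unfolding density using assms pos by (subst integral_density) (auto intro: less_imp_le)

lemma integrable_mu_iff:
  fixes f :: "real \<Rightarrow> real"
  assumes "f \<in> borel_measurable borel"
  shows "integrable \<mu> f \<longleftrightarrow> integrable lborel (\<lambda>x. \<phi> x * f x)"
  unfolding density using assms pos by (subst integrable_density) (auto intro: less_imp_le)

lemma AE_mu_iff: "(AE x in \<mu>. P x) \<longleftrightarrow> (AE x in lborel. P x)"
  unfolding density using pos by (subst AE_density) auto

lemma integrable_bounded:
  fixes f :: "real \<Rightarrow> real"
  assumes "f \<in> borel_measurable borel" "\<And>x. \<bar>f x\<bar> \<le> B"
  shows "integrable \<mu> f"
  by (rule integrable_const_bound[where B=B]) (use assms in auto)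

lemma cdf_integral:
  assumes "a \<le> b" shows "cdf \<mu> b - cdf \<mu> a = integral {a..b} \<phi>"
proof (cases "a = b")
  case False
  then have ab: "a < b" using assms by simp
  have int: "set_integrable lborel {a..b} \<phi>"
    by (rule borel_integrable_atLeastAtMost') (use cont continuous_on_subset in blast)
  then have int': "set_integrable lborel {a<..b} \<phi>"
    by (rule set_integrable_subset) auto
  have "cdf \<mu> b - cdf \<mu> a = measure \<mu> {a<..b}" by (rule cdf_diff_eq[OF ab])
  also have "\<dots> = (\<integral>x. indicator {a<..b} x \<partial>\<mu>)" by simp
  also have "\<dots> = (\<integral>x. \<phi> x * indicator {a<..b} x \<partial>lborel)" by (rule integral_mu) auto
  also have "\<dots> = set_lebesgue_integral lborel {a<..b} \<phi>"
    by (simp add: set_lebesgue_integral_def mult.commute)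
  also have "\<dots> = integral {a<..b} \<phi>" by (rule set_borel_integral_eq_integral(2)[OF int'])
  also have "\<dots> = integral {a..b} \<phi>"
  proof (rule integral_spike_set)
    show "negligible {x \<in> {a<..b} - {a..b}. \<phi> x \<noteq> 0}"
      by (rule negligible_subset[of "{}"]) auto
    show "negligible {x \<in> {a..b} - {a<..b}. \<phi> x \<noteq> 0}"
      by (rule negligible_subset[of "{a}"]) auto
  qed
  finally show ?thesis .
qed simp

lemma DERIV_cdf: "DERIV (cdf \<mu>) x :> \<phi> x"
proof -
  have "((\<lambda>y. integral {x-1..y} \<phi>) has_real_derivative \<phi> x) (at x within {x-1..x+1})"
    by (rule integral_has_real_derivative) (use cont continuous_on_subset in auto)
  then have "((\<lambda>y. integral {x-1..y} \<phi>) has_real_derivative \<phi> x) (at x)"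
    by (subst (asm) at_within_interior) (auto simp: interior_atLeastAtMost_real)
  then have d: "((\<lambda>y. cdf \<mu> (x-1) + integral {x-1..y} \<phi>) has_real_derivative \<phi> x) (at x)"
    by (auto intro!: derivative_eq_intros)
  show ?thesis
  proof (rule has_field_derivative_transform_within_open[OF d, of "{x-1<..}"])
    fix y assume "y \<in> {x-1<..}"
    then show "cdf \<mu> (x-1) + integral {x-1..y} \<phi> = cdf \<mu> y"
      using cdf_integral[of "x-1" y] by auto
  qed auto
qed

lemma cdf_strict_mono: "x < y \<Longrightarrow> cdf \<mu> x < cdf \<mu> y"
  by (rule DERIV_pos_imp_increasing) (use DERIV_cdf pos in blast)+

lemma cdf_less_iff [simp]: "cdf \<mu> x < cdf \<mu> y \<longleftrightarrow> x < y"
  by (metis cdf_strict_mono linorder_less_linear order_less_asym)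

lemma cdf_le_iff [simp]: "cdf \<mu> x \<le> cdf \<mu> y \<longleftrightarrow> x \<le> y"
  by (simp add: linorder_not_less[symmetric])

lemma cdf_eq_iff [simp]: "cdf \<mu> x = cdf \<mu> y \<longleftrightarrow> x = y"
  by (metis cdf_strict_mono linorder_less_linear order_less_irrefl)

lemma cdf_pos: "0 < cdf \<mu> x" and cdf_less_1: "cdf \<mu> x < 1"
  using cdf_strict_mono[of "x - 1" x] cdf_nonneg[of "x-1"]
    cdf_strict_mono[of x "x + 1"] cdf_bounded_prob[of "x+1"] by linarith+

lemma continuous_cdf: "continuous_on S (cdf \<mu>)"
  by (meson DERIV_cdf DERIV_isCont continuous_at_imp_continuous_on)

lemma borel_cdf [measurable]: "cdf \<mu> \<in> borel_measurable borel"
  by (rule borel_measurable_continuous_onI[OF continuous_cdf])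

definition Q :: "real \<Rightarrow> real" where "Q = the_inv (cdf \<mu>)"

lemma Q_cdf [simp]: "Q (cdf \<mu> x) = x"
  unfolding Q_def by (rule the_inv_f_f) (auto intro: injI)

lemma obtain_cdf:
  assumes "0 < p" "p < 1" obtains x where "p = cdf \<mu> x"
proof -
  have "eventually (\<lambda>x. cdf \<mu> x < p) at_bot"
    using cdf_lim_at_bot assms(1) by (rule order_tendstoD)
  then obtain a where a: "cdf \<mu> a < p" by (auto simp: eventually_at_bot_linorder)
  have "eventually (\<lambda>x. cdf \<mu> x > p) at_top"
    using cdf_lim_at_top_prob assms(2) by (rule order_tendstoD)
  then obtain b where b: "cdf \<mu> b > p" by (auto simp: eventually_at_top_linorder)
  have "a \<le> b" using a b by (meson cdf_le_iff less_imp_le order_less_trans cdf_less_iff)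
  then obtain x where "cdf \<mu> x = p"
    using IVT'[of "cdf \<mu>" a p b] a b continuous_cdf by auto
  then show ?thesis using that by auto
qed

lemma cdf_Q [simp]: "0 < p \<Longrightarrow> p < 1 \<Longrightarrow> cdf \<mu> (Q p) = p"
  by (metis Q_cdf obtain_cdf)

lemma Q_le_iff: "0 < p \<Longrightarrow> p < 1 \<Longrightarrow> Q p \<le> x \<longleftrightarrow> p \<le> cdf \<mu> x"
  by (metis cdf_Q cdf_le_iff)

lemma le_Q_iff: "0 < p \<Longrightarrow> p < 1 \<Longrightarrow> x \<le> Q p \<longleftrightarrow> cdf \<mu> x \<le> p"
  by (metis cdf_Q cdf_le_iff)

lemma Q_mono: "0 < p \<Longrightarrow> p \<le> q \<Longrightarrow> q < 1 \<Longrightarrow> Q p \<le> Q q"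
  by (simp add: Q_le_iff)

lemma DERIV_Q:
  assumes "0 < p" "p < 1" shows "DERIV Q p :> 1 / \<phi> (Q p)"
proof -
  have cont: "isCont Q p"
  proof -
    define x where "x = Q p"
    have "isCont Q (cdf \<mu> x)"
      by (rule isCont_inverse_function[of 1]) (use DERIV_cdf DERIV_isCont in auto)
    then show ?thesis using assms by (simp add: x_def)
  qed
  have "DERIV Q p :> inverse (\<phi> (Q p))"
    by (rule DERIV_inverse_function[where f="cdf \<mu>" and a=0 and b=1])
       (use DERIV_cdf pos[of "Q p"] assms cont in auto)
  then show ?thesis by (simp add: inverse_eq_divide)
qed

lemma continuous_Q: "continuous_on {0<..<1} Q"
  by (rule continuous_at_imp_continuous_on) (use DERIV_Q DERIV_isCont in force)

text \<open>
A mean of the distribution function along a bounded profile stays in a compact part of \<open>(0, 1)\<close>,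
where the inverse is Lipschitz.
\<close>

lemma mean_cdf_bounds:
  assumes [measurable]: "f \<in> borel_measurable borel" and M: "\<And>x. \<bar>f x\<bar> \<le> M"
  shows "cdf \<mu> (-M) \<le> (\<integral>x. cdf \<mu> (f x) \<partial>\<mu>)" "(\<integral>x. cdf \<mu> (f x) \<partial>\<mu>) \<le> cdf \<mu> M"
proof -
  have i: "integrable \<mu> (\<lambda>x. cdf \<mu> (f x))"
    by (rule integrable_bounded[where B=1]) (auto simp: cdf_nonneg cdf_bounded_prob)
  have "- M \<le> f x" "f x \<le> M" for x using M[of x] by auto
  then show "cdf \<mu> (-M) \<le> (\<integral>x. cdf \<mu> (f x) \<partial>\<mu>)" "(\<integral>x. cdf \<mu> (f x) \<partial>\<mu>) \<le> cdf \<mu> M"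
    by (auto intro!: integral_ge_const integral_le_const i)
qed

end


section \<open>The functional inequality forces a Gaussian density\<close>

context positive_density begin

lemma Phi_inv_eq: "0 < p \<Longrightarrow> p < 1 \<Longrightarrow> Phi_inv \<mu> p = ereal (Q p)"
  by (simp add: Phi_inv_def Q_def)

lemma H_interior:
  assumes "0 < p" "p < 1" "0 < q" "q < 1"
  shows "H \<mu> a b p q = cdf \<mu> (a * Q p + b * Q q)"
  using assms by (simp add: H_def Phi_inv_eq Phi_def)

lemma mean_cdf_in_01:
  assumes [measurable]: "f \<in> borel_measurable borel"
  shows "0 < (\<integral>x. cdf \<mu> (f x) \<partial>\<mu>)" "(\<integral>x. cdf \<mu> (f x) \<partial>\<mu>) < 1"
proof -
  have i: "integrable \<mu> (\<lambda>x. cdf \<mu> (f x))"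
    by (rule integrable_bounded[where B=1]) (auto simp: cdf_nonneg cdf_bounded_prob)
  show "0 < (\<integral>x. cdf \<mu> (f x) \<partial>\<mu>)" "(\<integral>x. cdf \<mu> (f x) \<partial>\<mu>) < 1"
    using expectation_greater[OF i, of 0] expectation_less[OF i, of 1] cdf_pos cdf_less_1 by auto
qed

text \<open>
Second order expansion of the distribution function. L'Hospital's rule reduces it to the difference
quotient of the density, so that the density only has to be differentiable at the one point \<open>u\<close>.
\<close>

lemma taylor_remainder_limit:
  assumes d: "DERIV \<phi> u :> d"
  shows "((\<lambda>h. (cdf \<mu> (u + h) - cdf \<mu> u - \<phi> u * h) / h\<^sup>2) \<longlongrightarrow> d / 2) (at 0)"
proof (rule lhopital[where f'="\<lambda>h. \<phi> (u + h) - \<phi> u" and g'="\<lambda>h. 2 * h"])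
  have shift: "DERIV (\<lambda>h. cdf \<mu> (u + h)) h :> \<phi> (u + h)" for h
    using DERIV_shift[of "cdf \<mu>" "\<phi> (u + h)" h u] DERIV_cdf[of "u + h"]
    by (simp add: add.commute)
  have D: "DERIV (\<lambda>h. cdf \<mu> (u + h) - cdf \<mu> u - \<phi> u * h) h :> \<phi> (u + h) - \<phi> u" for h
    using DERIV_diff[OF DERIV_diff[OF shift DERIV_const[of "cdf \<mu> u"]] DERIV_cmult[OF DERIV_ident, of "\<phi> u"], of h]
    by simp
  then show "\<forall>\<^sub>F h in at 0. DERIV (\<lambda>h. cdf \<mu> (u + h) - cdf \<mu> u - \<phi> u * h) h :> \<phi> (u + h) - \<phi> u"
    by (intro always_eventually allI)
  show "((\<lambda>h. cdf \<mu> (u + h) - cdf \<mu> u - \<phi> u * h) \<longlongrightarrow> 0) (at 0)"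
    using DERIV_isCont[OF D[of 0]] by (simp add: isCont_def)
  show "((\<lambda>h::real. h\<^sup>2) \<longlongrightarrow> 0) (at 0)"
    using tendsto_power[OF tendsto_ident_at[of "0::real" UNIV], of 2] by simp
  show "\<forall>\<^sub>F h in at (0::real). h\<^sup>2 \<noteq> 0" "\<forall>\<^sub>F h in at (0::real). 2 * h \<noteq> 0"
    by (auto simp: eventually_at_filter)
  show "\<forall>\<^sub>F h in at (0::real). DERIV (\<lambda>h. h\<^sup>2) h :> 2 * h"
    by (intro always_eventually allI) (auto intro!: derivative_eq_intros)
  have "((\<lambda>h. (\<phi> (u + h) - \<phi> u) / h) \<longlongrightarrow> d) (at 0)"
    using d by (simp add: DERIV_def)
  then have "((\<lambda>h. (\<phi> (u + h) - \<phi> u) / h / 2) \<longlongrightarrow> d / 2) (at 0)"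
    by (rule tendsto_divide) auto
  then show "((\<lambda>h. (\<phi> (u + h) - \<phi> u) / (2 * h)) \<longlongrightarrow> d / 2) (at 0)"
    by (simp add: mult.commute)
qed

text \<open>
The remainder is quadratically small near \<open>0\<close>, and elsewhere it grows at most linearly because the
distribution function is bounded. The resulting global quadratic bound lets the second moment
dominate the remainder under the integral.
\<close>

lemma taylor_remainder_bound:
  assumes d: "DERIV \<phi> u :> d"
  shows "\<exists>C. \<forall>h. \<bar>cdf \<mu> (u + h) - cdf \<mu> u - \<phi> u * h\<bar> \<le> C * h\<^sup>2"
proof -
  define T where "T h = cdf \<mu> (u + h) - cdf \<mu> u - \<phi> u * h" for h
  have "((\<lambda>h. \<bar>T h / h\<^sup>2\<bar>) \<longlongrightarrow> \<bar>d / 2\<bar>) (at 0)"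
    unfolding T_def by (intro tendsto_rabs taylor_remainder_limit d)
  then have "\<forall>\<^sub>F h in at 0. \<bar>T h / h\<^sup>2\<bar> < \<bar>d / 2\<bar> + 1"
    by (rule order_tendstoD) auto
  then obtain r where r: "r > 0" "\<And>h. h \<noteq> 0 \<Longrightarrow> \<bar>h\<bar> < r \<Longrightarrow> \<bar>T h / h\<^sup>2\<bar> < \<bar>d / 2\<bar> + 1"
    by (auto simp: eventually_at dist_real_def)
  define C where "C = max (\<bar>d / 2\<bar> + 1) (1 / r\<^sup>2 + \<phi> u / r)"
  have "\<bar>T h\<bar> \<le> C * h\<^sup>2" for h
  proof -
    consider "h = 0" | "h \<noteq> 0" "\<bar>h\<bar> < r" | "\<bar>h\<bar> \<ge> r" by linarith
    then show ?thesis
    proof cases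
      case 2
      then have "\<bar>T h\<bar> \<le> (\<bar>d / 2\<bar> + 1) * h\<^sup>2"
        using r(2)[of h] by (simp add: divide_simps abs_mult split: if_splits)
      also have "\<dots> \<le> C * h\<^sup>2" by (intro mult_right_mono) (auto simp: C_def)
      finally show ?thesis .
    next
      case 3
      \<comment> \<open>away from \<open>0\<close>, powers of \<open>\<bar>h\<bar> / r \<ge> 1\<close> raise the constant and the linear term to quadratic order\<close>
      have h1: "1 \<le> \<bar>h\<bar> / r" using 3 r(1) by simp
      have "\<bar>cdf \<mu> (u + h) - cdf \<mu> u\<bar> \<le> 1"
        using cdf_pos[of "u+h"] cdf_less_1[of "u+h"] cdf_pos[of u] cdf_less_1[of u] by linarith
      then have "\<bar>T h\<bar> \<le> 1 + \<bar>\<phi> u * h\<bar>"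
        unfolding T_def by linarith
      then have "\<bar>T h\<bar> \<le> 1 + \<phi> u * \<bar>h\<bar>" using pos[of u] by (simp add: abs_mult)
      also have "\<dots> \<le> (\<bar>h\<bar> / r)\<^sup>2 + \<phi> u * \<bar>h\<bar> * (\<bar>h\<bar> / r)"
        using one_le_power[OF h1, of 2] mult_left_mono[OF h1, of "\<phi> u * \<bar>h\<bar>"] pos[of u]
        by (intro add_mono) auto
      also have "\<dots> = (1 / r\<^sup>2 + \<phi> u / r) * h\<^sup>2"
        by (simp add: field_simps power2_eq_square)
      also have "\<dots> \<le> C * h\<^sup>2" by (intro mult_right_mono) (auto simp: C_def)
      finally show ?thesis .
    qed (simp add: T_def)
  qed
  then show ?thesis unfolding T_def by blast
qed

text \<open>
The first order term \<open>\<phi> u * e n * x\<close> integrates to \<open>0\<close>, so the mean of \<open>\<Phi> (u + e n * x)\<close> differs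
from \<open>\<Phi> u\<close> by \<open>(e n)\<^sup>2 * d / 2\<close> times the second moment, up to higher order. Applying the inverse
divides this by its derivative \<open>1 / \<phi> u\<close>. For \<open>\<phi> = exp (- V)\<close> the ratio \<open>d / \<phi> u\<close> is \<open>- V' u\<close>.
\<close>

lemma linear_perturbation_limit:
  assumes d: "DERIV \<phi> u :> d"
    and m1: "integrable \<mu> (\<lambda>x. x)" "(\<integral>x. x \<partial>\<mu>) = 0"
    and m2: "integrable \<mu> (\<lambda>x. x\<^sup>2)"
    and e: "\<And>n. e n > 0" "e \<longlonglongrightarrow> 0"
  shows "(\<lambda>n. (Q (\<integral>x. cdf \<mu> (u + e n * x) \<partial>\<mu>) - u) / (e n)\<^sup>2)
           \<longlonglongrightarrow> d / (2 * \<phi> u) * (\<integral>x. x\<^sup>2 \<partial>\<mu>)"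
proof -
  have enz: "e n \<noteq> 0" for n using e(1)[of n] by simp
  define T where "T h = cdf \<mu> (u + h) - cdf \<mu> u - \<phi> u * h" for h
  have [measurable]: "T \<in> borel_measurable borel" unfolding T_def by measurable
  obtain C where C: "\<bar>T h\<bar> \<le> C * h\<^sup>2" for h
    using taylor_remainder_bound[OF d] unfolding T_def by blast
  define A where "A n = (\<integral>x. cdf \<mu> (u + e n * x) \<partial>\<mu>)" for n
  have ph: "integrable \<mu> (\<lambda>x. cdf \<mu> (u + e n * x))" for n
    by (rule integrable_bounded[where B=1]) (auto simp: cdf_nonneg cdf_bounded_prob)
  have "A n - cdf \<mu> u = (\<integral>x. T (e n * x) \<partial>\<mu>)" for n
    using ph m1 prob_space by (simp add: A_def T_def)
  then have A: "(A n - cdf \<mu> u) / (e n)\<^sup>2 = (\<integral>x. T (e n * x) / (e n)\<^sup>2 \<partial>\<mu>)" for n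
    by simp
  have "(\<lambda>n. \<integral>x. T (e n * x) / (e n)\<^sup>2 \<partial>\<mu>) \<longlonglongrightarrow> (\<integral>x. d / 2 * x\<^sup>2 \<partial>\<mu>)"
  proof (rule integral_dominated_convergence[where w="\<lambda>x. C * x\<^sup>2"])
    show "AE x in \<mu>. (\<lambda>n. T (e n * x) / (e n)\<^sup>2) \<longlonglongrightarrow> d / 2 * x\<^sup>2"
    proof (rule AE_I2)
      fix x
      show "(\<lambda>n. T (e n * x) / (e n)\<^sup>2) \<longlonglongrightarrow> d / 2 * x\<^sup>2"
      proof (cases "x = 0")
        case False
        have nz: "filterlim (\<lambda>n. e n * x) (at 0) sequentially"
          unfolding filterlim_at using e False
          by (auto intro!: tendsto_eq_intros always_eventually simp: enz)
        have "(\<lambda>n. T (e n * x) / (e n * x)\<^sup>2) \<longlonglongrightarrow> d / 2"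
          using filterlim_compose[OF taylor_remainder_limit[OF d] nz] by (simp add: T_def)
        then have "(\<lambda>n. T (e n * x) / (e n * x)\<^sup>2 * x\<^sup>2) \<longlonglongrightarrow> d / 2 * x\<^sup>2"
          by (rule tendsto_mult_right)
        then show ?thesis using False by (simp add: power_mult_distrib)
      qed (simp add: T_def)
    qed
    show "AE x in \<mu>. norm (T (e n * x) / (e n)\<^sup>2) \<le> C * x\<^sup>2" for n
      using C[of "e n * x" for x] e(1)[of n]
      by (auto simp: divide_simps power_mult_distrib mult_ac intro!: AE_I2)
    show "integrable \<mu> (\<lambda>x. C * x\<^sup>2)" using m2 by (rule integrable_mult_right)
    show "(\<lambda>x. d / 2 * x\<^sup>2) \<in> borel_measurable \<mu>" "(\<lambda>x. T (e n * x) / (e n)\<^sup>2) \<in> borel_measurable \<mu>" for n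
      by measurable
  qed
  then have B: "(\<lambda>n. (A n - cdf \<mu> u) / (e n)\<^sup>2) \<longlonglongrightarrow> d / 2 * (\<integral>x. x\<^sup>2 \<partial>\<mu>)"
    unfolding A by simp
  then have "(\<lambda>n. (A n - cdf \<mu> u) / (e n)\<^sup>2 * (e n)\<^sup>2) \<longlonglongrightarrow> d / 2 * (\<integral>x. x\<^sup>2 \<partial>\<mu>) * 0\<^sup>2"
    by (intro tendsto_intros e)
  then have "(\<lambda>n. A n - cdf \<mu> u) \<longlonglongrightarrow> 0"
    by (simp add: enz)
  then have Au: "A \<longlonglongrightarrow> cdf \<mu> u" by (simp add: LIM_zero_iff)
  have DQ: "DERIV Q (cdf \<mu> u) :> 1 / \<phi> u"
    using DERIV_Q[OF cdf_pos cdf_less_1, of u] by simp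
  \<comment> \<open>Caratheodory's form of the derivative of the inverse avoids dividing by \<open>A n - \<Phi> u\<close>, which may vanish\<close>
  obtain g where g: "\<forall>z. Q z - Q (cdf \<mu> u) = g z * (z - cdf \<mu> u)"
      "isCont g (cdf \<mu> u)" "g (cdf \<mu> u) = 1 / \<phi> u"
    using iffD1[OF CARAT_DERIV DQ] by blast
  have lim: "(\<lambda>n. g (A n) * ((A n - cdf \<mu> u) / (e n)\<^sup>2)) \<longlonglongrightarrow> g (cdf \<mu> u) * (d / 2 * (\<integral>x. x\<^sup>2 \<partial>\<mu>))"
    by (intro tendsto_mult B isCont_tendsto_compose[OF g(2)] Au)
  have eq: "g (A n) * ((A n - cdf \<mu> u) / (e n)\<^sup>2) = (Q (A n) - u) / (e n)\<^sup>2" for n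
    using spec[OF g(1), of "A n"] by simp
  have "g (cdf \<mu> u) * (d / 2 * (\<integral>x. x\<^sup>2 \<partial>\<mu>)) = d / (2 * \<phi> u) * (\<integral>x. x\<^sup>2 \<partial>\<mu>)"
    by (simp add: g(3))
  from lim[unfolded eq this] show ?thesis unfolding A_def .
qed

text \<open>
For the linear profiles \<open>u + e * x\<close> and \<open>v + e * x\<close> the sum
\<open>a * (u + e * ((x - y) / a)) + b * (v + e * (y / b))\<close> is independent of \<open>y\<close>: the essential supremum is
taken over a constant.
\<close>

lemma functional_inequality_linear:
  assumes ab: "a > 0" "b > 0"
    and ineq: "\<And>f g. f \<in> borel_measurable borel \<Longrightarrow> g \<in> borel_measurable borel \<Longrightarrow>
        (\<forall>x. 0 \<le> f x \<and> f x \<le> 1) \<Longrightarrow> (\<forall>x. 0 \<le> g x \<and> g x \<le> 1) \<Longrightarrow>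
        (\<integral>\<^sup>+ x. esssup lborel (\<lambda>y. ennreal (H \<mu> a b (f ((x - y) / a)) (g (y / b)))) \<partial>\<mu>)
          \<ge> ennreal (H \<mu> a b (\<integral>x. f x \<partial>\<mu>) (\<integral>x. g x \<partial>\<mu>))"
  shows "a * Q (\<integral>x. cdf \<mu> (u + e * x) \<partial>\<mu>) + b * Q (\<integral>x. cdf \<mu> (v + e * x) \<partial>\<mu>)
           \<le> Q (\<integral>x. cdf \<mu> (a * u + b * v + e * x) \<partial>\<mu>)" (is "?l \<le> Q ?A")
proof -
  have mean01: "0 < (\<integral>x. cdf \<mu> (s + e * x) \<partial>\<mu>)" "(\<integral>x. cdf \<mu> (s + e * x) \<partial>\<mu>) < 1" for s
    by (rule mean_cdf_in_01; simp)+
  have "a * (u + e * ((x - y) / a)) + b * (v + e * (y / b)) = a * u + b * v + e * x" for x y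
    using ab by (simp add: field_simps)
  then have "H \<mu> a b (cdf \<mu> (u + e * ((x - y) / a))) (cdf \<mu> (v + e * (y / b)))
      = cdf \<mu> (a * u + b * v + e * x)" for x y
    by (simp add: H_interior cdf_pos cdf_less_1 del: times_divide_eq_right)
  then have "ennreal (cdf \<mu> ?l) \<le>
      (\<integral>\<^sup>+ x. esssup lborel (\<lambda>y::real. ennreal (cdf \<mu> (a * u + b * v + e * x))) \<partial>\<mu>)"
    using ineq[of "\<lambda>x. cdf \<mu> (u + e * x)" "\<lambda>x. cdf \<mu> (v + e * x)"] mean01
    by (simp add: H_interior cdf_nonneg cdf_bounded_prob del: times_divide_eq_right)
  also have "\<dots> = (\<integral>\<^sup>+ x. ennreal (cdf \<mu> (a * u + b * v + e * x)) \<partial>\<mu>)"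
    by (simp add: esssup_const)
  also have "\<dots> = ennreal ?A"
    by (rule nn_integral_eq_integral)
       (auto simp: cdf_nonneg cdf_bounded_prob intro!: integrable_bounded[where B=1])
  finally have "cdf \<mu> ?l \<le> ?A" using mean01[of "a * u + b * v"] by (simp add: cdf_nonneg)
  then show ?thesis using mean01 by (simp add: le_Q_iff)
qed

text \<open>
Evenness of the measure only says that the density is even almost everywhere. Differentiating
\<open>\<Phi> (- x) = 1 - \<Phi> x\<close> gives it at every point.
\<close>

lemma even_density:
  assumes "even_measure \<mu>" shows "\<phi> (- x) = \<phi> x"
proof -
  have "cdf \<mu> (- x) = 1 - cdf \<mu> x" for x
  proof -
    have "cdf \<mu> (-x) = measure (distr \<mu> borel uminus) {..-x}"
      using assms by (simp add: even_measure_def cdf_def)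
    also have "\<dots> = measure \<mu> {x..}"
      by (subst measure_distr) (auto intro!: arg_cong[where f="measure \<mu>"])
    also have "\<dots> = 1 - measure \<mu> {..<x}"
      using prob_compl[of "{..<x}"] by (simp add: Compl_eq_Diff_UNIV[symmetric] Compl_lessThan)
    also have "measure \<mu> {..<x} = cdf \<mu> x"
    proof -
      have "isCont (cdf \<mu>) x" using DERIV_cdf DERIV_isCont by blast
      then have "measure \<mu> {x} = 0" by (simp add: isCont_cdf)
      moreover have "measure \<mu> ({..<x} \<union> {x}) = measure \<mu> {..<x} + measure \<mu> {x}"
        by (rule finite_measure_Union) auto
      moreover have "{..<x} \<union> {x} = {..x}" by auto
      ultimately show ?thesis by (simp add: cdf_def)
    qed
    finally show ?thesis .
  qed
  then have eq: "(\<lambda>x. cdf \<mu> (- x)) = (\<lambda>x. 1 - cdf \<mu> x)" by auto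
  have d1: "DERIV (\<lambda>x. cdf \<mu> (- x)) x :> \<phi> (- x) * (-1)"
    by (rule DERIV_chain2[OF DERIV_cdf]) (auto intro!: derivative_eq_intros)
  have d2: "DERIV (\<lambda>x. 1 - cdf \<mu> x) x :> - \<phi> x"
    by (auto intro!: derivative_eq_intros DERIV_cdf)
  show ?thesis using DERIV_unique[OF d1[unfolded eq] d2] by simp
qed

end


text \<open>
The second order terms of the inequality for linear profiles give
\<open>V' (a u + b v) \<le> a V' u + b V' v\<close>. Oddness of \<open>V'\<close> yields the reverse, so \<open>V'\<close> is additive, its
derivative is constant, and integrability fixes the sign of the leading coefficient of \<open>V\<close>.
\<close>

lemma gaussian_of_functional_inequality:
  fixes V :: "real \<Rightarrow> real"
  assumes \<mu>: "positive_density \<mu> (\<lambda>x. exp (- V x))"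
    and even: "even_measure \<mu>"
    and m2: "integrable \<mu> (\<lambda>x. x\<^sup>2)"
    and V: "\<And>x. DERIV V x :> V' x" "\<And>x. DERIV V' x :> V'' x"
    and ab: "a > 0" "b > 0"
    and ineq: "\<And>f g. f \<in> borel_measurable borel \<Longrightarrow> g \<in> borel_measurable borel \<Longrightarrow>
        (\<forall>x. 0 \<le> f x \<and> f x \<le> 1) \<Longrightarrow> (\<forall>x. 0 \<le> g x \<and> g x \<le> 1) \<Longrightarrow>
        (\<integral>\<^sup>+ x. esssup lborel (\<lambda>y. ennreal (H \<mu> a b (f ((x - y) / a)) (g (y / b)))) \<partial>\<mu>)
          \<ge> ennreal (H \<mu> a b (\<integral>x. f x \<partial>\<mu>) (\<integral>x. g x \<partial>\<mu>))"
  shows "gaussian_measure \<mu>"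
proof -
  interpret positive_density \<mu> "\<lambda>x. exp (- V x)" by fact
  have m1: "integrable \<mu> (\<lambda>x. x)"
  proof (rule Bochner_Integration.integrable_bound[of _ "\<lambda>x. 1 + x\<^sup>2"])
    show "AE x in \<mu>. norm x \<le> norm (1 + x\<^sup>2)"
    proof (rule AE_I2)
      fix x :: real
      have "2 * \<bar>x\<bar> \<le> 1 + x\<^sup>2" using zero_le_power2[of "\<bar>x\<bar> - 1"] by (simp add: power2_diff)
      then show "norm x \<le> norm (1 + x\<^sup>2)" by simp
    qed
  qed (use m2 in auto)
  have m1z: "(\<integral>x. x \<partial>\<mu>) = 0"
  proof -
    have "(\<integral>x. x \<partial>\<mu>) = (\<integral>x. x \<partial>distr \<mu> borel uminus)"
      using even by (simp add: even_measure_def)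
    also have "\<dots> = - (\<integral>x. x \<partial>\<mu>)" by (subst integral_distr) auto
    finally show ?thesis by simp
  qed
  have m2pos: "(\<integral>x. x\<^sup>2 \<partial>\<mu>) > 0"
  proof -
    have "(\<integral>x. x\<^sup>2 \<partial>\<mu>) \<noteq> 0"
    proof
      assume "(\<integral>x. x\<^sup>2 \<partial>\<mu>) = 0"
      then have "AE x in \<mu>. x\<^sup>2 = 0"
        using integral_nonneg_eq_0_iff_AE[OF m2] by auto
      then have "AE x in lborel. x = (0::real)" by (simp add: AE_mu_iff)
      with AE_lborel_singleton[of 0] have "AE x::real in lborel. False" by eventually_elim simp
      then show False by (simp add: AE_iff_measurable[of UNIV])
    qed
    then show ?thesis by (simp add: order_less_le)
  qed
  have V_even: "V (- x) = V x" for x using even_density[OF even, of x] by simp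
  have V'_odd: "V' (- x) = - V' x" for x
  proof -
    have d: "DERIV (\<lambda>x. V (- x)) x :> V' (- x) * (-1)"
      by (rule DERIV_chain2[OF V(1)]) (auto intro!: derivative_eq_intros)
    show ?thesis using DERIV_unique[OF d[unfolded V_even] V(1)] by simp
  qed
  define e where "e n = inverse (real (Suc n))" for n
  have e: "e n > 0" "e \<longlonglongrightarrow> 0" for n
    unfolding e_def by (simp, rule LIMSEQ_inverse_real_of_nat)
  have lin: "a * Q (\<integral>x. cdf \<mu> (u + e n * x) \<partial>\<mu>) + b * Q (\<integral>x. cdf \<mu> (v + e n * x) \<partial>\<mu>)
      \<le> Q (\<integral>x. cdf \<mu> (a * u + b * v + e n * x) \<partial>\<mu>)" for u n v
    by (rule functional_inequality_linear[OF ab]) (rule ineq)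
  have le: "V' (a * u + b * v) \<le> a * V' u + b * V' v" for u v
  proof -
    define K where "K s n = (Q (\<integral>x. cdf \<mu> (s + e n * x) \<partial>\<mu>) - s) / (e n)\<^sup>2" for s n
    have lim: "K s \<longlonglongrightarrow> - V' s / 2 * (\<integral>x. x\<^sup>2 \<partial>\<mu>)" for s
    proof -
      have "DERIV (\<lambda>x. exp (- V x)) s :> - V' s * exp (- V s)"
        by (auto intro!: derivative_eq_intros V)
      from linear_perturbation_limit[OF this m1 m1z m2 e] show ?thesis by (simp add: K_def[abs_def])
    qed
    have Kle: "a * K u n + b * K v n \<le> K (a * u + b * v) n" for n
    proof -
      have "(a * (Q (\<integral>x. cdf \<mu> (u + e n * x) \<partial>\<mu>) - u) + b * (Q (\<integral>x. cdf \<mu> (v + e n * x) \<partial>\<mu>) - v)) / (e n)\<^sup>2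
          \<le> K (a * u + b * v) n"
        unfolding K_def
        by (rule divide_right_mono) (use lin[of u n v] in \<open>simp_all add: algebra_simps\<close>)
      then show ?thesis by (simp add: K_def add_divide_distrib)
    qed
    have "a * (- V' u / 2 * (\<integral>x. x\<^sup>2 \<partial>\<mu>)) + b * (- V' v / 2 * (\<integral>x. x\<^sup>2 \<partial>\<mu>))
        \<le> - V' (a * u + b * v) / 2 * (\<integral>x. x\<^sup>2 \<partial>\<mu>)"
      by (rule LIMSEQ_le[OF tendsto_add[OF tendsto_mult_left[OF lim] tendsto_mult_left[OF lim]] lim])
         (use Kle in blast)
    then have "V' (a * u + b * v) * (\<integral>x. x\<^sup>2 \<partial>\<mu>) \<le> (a * V' u + b * V' v) * (\<integral>x. x\<^sup>2 \<partial>\<mu>)"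
      by (simp add: algebra_simps)
    then show ?thesis using m2pos by simp
  qed
  \<comment> \<open>the reverse inequality is the same one at \<open>(- u, - v)\<close>, by oddness\<close>
  have eq: "V' (a * u + b * v) = a * V' u + b * V' v" for u v
    using le[of u v] le[of "-u" "-v"] V'_odd[of u] V'_odd[of v] V'_odd[of "a * u + b * v"] by simp
  have V'0: "V' 0 = 0" using V'_odd[of 0] by simp
  have add: "V' (s + t) = V' s + V' t" for s t
    using eq[of "s/a" "t/b"] eq[of "s/a" 0] eq[of 0 "t/b"] ab V'0 by simp
  \<comment> \<open>additivity makes the difference quotients of \<open>V'\<close> the same at every point\<close>
  have V''_const: "V'' t = V'' 0" for t
  proof -
    have d1: "DERIV (\<lambda>s. V' (s + t)) 0 :> V'' (0 + t) * 1"
      by (rule DERIV_chain2[OF V(2)]) (auto intro!: derivative_eq_intros)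
    have d2: "DERIV (\<lambda>s. V' s + V' t) 0 :> V'' 0"
      by (auto intro!: derivative_eq_intros V)
    show ?thesis using DERIV_unique[OF d1[unfolded add] d2] by simp
  qed
  define k where "k = V'' 0"
  have V'_lin: "V' x = k * x" for x
  proof -
    have "DERIV (\<lambda>x. V' x - k * x) y :> 0" for y
      using V(2)[of y] by (auto intro!: derivative_eq_intros simp: V''_const[of y] k_def)
    then have "V' x - k * x = V' 0 - k * 0" by (intro DERIV_isconst_all) auto
    then show ?thesis using V'0 by simp
  qed
  have V_quad: "V x = k / 2 * x\<^sup>2 + V 0" for x
  proof -
    have "DERIV (\<lambda>x. V x - k / 2 * x\<^sup>2) y :> 0" for y
      using V(1)[of y] by (auto intro!: derivative_eq_intros simp: V'_lin)
    then have "V x - k / 2 * x\<^sup>2 = V 0 - k / 2 * 0\<^sup>2" by (intro DERIV_isconst_all) auto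
    then show ?thesis by simp
  qed
  have "k > 0"
  proof (rule ccontr)
    assume "\<not> k > 0"
    then have ge: "exp (- V 0) \<le> exp (- V x)" for x
      using mult_nonpos_nonneg[of k "x\<^sup>2"] V_quad[of x] by simp
    have "(\<integral>\<^sup>+ (x::real). ennreal (exp (- V 0)) \<partial>lborel) \<le> (\<integral>\<^sup>+ x. ennreal (exp (- V x)) \<partial>lborel)"
      by (intro nn_integral_mono ennreal_leI ge)
    also have "\<dots> = emeasure \<mu> UNIV"
      by (subst density) (simp add: emeasure_density)
    also have "\<dots> = 1" using emeasure_space_1 by simp
    finally show False by (simp add: ennreal_mult_top top_unique)
  qed
  then have k2: "k / 2 > 0" by simp
  have "\<mu> = density lborel (\<lambda>x. ennreal (exp (- (k / 2) * x\<^sup>2 + 0 * x + (- V 0))))"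
  proof -
    have "- V x = - (k / 2) * x\<^sup>2 + 0 * x + (- V 0)" for x using V_quad[of x] by simp
    then have "(\<lambda>x. ennreal (exp (- V x))) = (\<lambda>x. ennreal (exp (- (k / 2) * x\<^sup>2 + 0 * x + (- V 0))))"
      by (intro ext arg_cong[where f="\<lambda>t. ennreal (exp t)"])
    from trans[OF density arg_cong[where f="density lborel", OF this]] show ?thesis .
  qed
  with k2 have "\<exists>\<alpha> \<beta> c. \<alpha> > 0 \<and> \<mu> = density lborel (\<lambda>x. ennreal (exp (- \<alpha> * x\<^sup>2 + \<beta> * x + c)))"
    by (intro exI conjI)
  with prob show ?thesis unfolding gaussian_measure_def by (rule conjI)
qed


section \<open>Smoothing by forward averages\<close>

text \<open>
The window extends to the right only, matching the one-sided boxes in the differentiation theorem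
\<open>integrable_ccontinuous_explicit\<close>.
\<close>

definition avg :: "real \<Rightarrow> (real \<Rightarrow> real) \<Rightarrow> real \<Rightarrow> real" where
  "avg h u x = integral {x..x+h} u / h"

definition bounded_borel :: "(real \<Rightarrow> real) \<Rightarrow> bool" where
  "bounded_borel u \<longleftrightarrow> u \<in> borel_measurable borel \<and> (\<exists>M. \<forall>x. \<bar>u x\<bar> \<le> M)"

lemma bounded_borelD: "bounded_borel u \<Longrightarrow> u \<in> borel_measurable borel"
  by (simp add: bounded_borel_def)

lemma bounded_borel_set_integrable:
  assumes "bounded_borel u" shows "set_integrable lborel {a..b} u"
proof -
  obtain M where M: "\<And>x. \<bar>u x\<bar> \<le> M" using assms by (auto simp: bounded_borel_def)
  have [measurable]: "u \<in> borel_measurable borel" using assms by (simp add: bounded_borel_def)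
  show ?thesis unfolding set_integrable_def
  proof (rule Bochner_Integration.integrable_bound)
    show "integrable lborel (\<lambda>x. M * indicator {a..b} x)"
      by (simp add: emeasure_lborel_Icc_eq)
    show "AE x in lborel. norm (indicator {a..b} x *\<^sub>R u x) \<le> norm (M * indicator {a..b} x)"
      using M by (auto intro!: AE_I2 simp: indicator_def intro: order_trans[OF _ abs_ge_self])
  qed measurable
qed

lemma bounded_borel_integrable_on:
  "bounded_borel u \<Longrightarrow> u integrable_on {a..b}"
  using set_borel_integral_eq_integral(1)[OF bounded_borel_set_integrable] by blast

lemma unif_density:
  assumes "h > 0"
  shows "uniform_measure lborel {0..h} = density lborel (\<lambda>s. ennreal (indicator {0..h} s / h))"
  unfolding uniform_measure_def
  by (rule density_cong) (use assms in \<open>auto intro!: AE_I2 simp: indicator_def divide_ennreal ennreal_1[symmetric] simp del: ennreal_1\<close>)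

text \<open>
The gauge integral is convenient for derivatives, the integral over a uniform distribution for
exchanging the average with almost-everywhere statements.
\<close>

lemma avg_eq_integral:
  assumes h: "h > 0" and u: "bounded_borel u"
  shows "avg h u x = (\<integral>s. u (x + s) \<partial>uniform_measure lborel {0..h})"
proof -
  have [measurable]: "u \<in> borel_measurable borel" using u by (simp add: bounded_borel_def)
  have "integral {x..x+h} u = (\<integral>y. indicator {x..x+h} y * u y \<partial>lborel)"
    using set_borel_integral_eq_integral(2)[OF bounded_borel_set_integrable[OF u, of x "x+h"]]
    by (simp add: set_lebesgue_integral_def)
  also have "\<dots> = (\<integral>s. indicator {x..x+h} (x + 1 * s) * u (x + 1 * s) \<partial>lborel)"
    by (subst lborel_integral_real_affine[where c=1 and t=x]) auto
  also have "\<dots> = (\<integral>s. h * (indicator {0..h} s / h * u (x + s)) \<partial>lborel)"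
    using h by (intro Bochner_Integration.integral_cong) (auto simp: indicator_def)
  also have "\<dots> = h * (\<integral>s. indicator {0..h} s / h * u (x + s) \<partial>lborel)" by simp
  also have "(\<integral>s. indicator {0..h} s / h * u (x + s) \<partial>lborel)
      = (\<integral>s. u (x + s) \<partial>uniform_measure lborel {0..h})"
    unfolding unif_density[OF h] using h by (subst integral_density) (auto intro!: AE_I2)
  finally show ?thesis using h by (simp add: avg_def)
qed

lemma unif_prob: "h > 0 \<Longrightarrow> prob_space (uniform_measure lborel {0..h::real})"
  by (rule prob_space_uniform_measure) auto

lemma unif_AE: "(AE x in lborel. P x) \<Longrightarrow> AE x in uniform_measure lborel {0..h::real}. P x"
  by (rule AE_uniform_measureI) auto

lemma unif_integrable:
  assumes "h > 0" "bounded_borel u"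
  shows "integrable (uniform_measure lborel {0..h}) (\<lambda>s. u (x + s))"
proof -
  interpret prob_space "uniform_measure lborel {0..h}" by (rule unif_prob[OF assms(1)])
  obtain M where M: "\<And>x. \<bar>u x\<bar> \<le> M" using assms by (auto simp: bounded_borel_def)
  have [measurable]: "u \<in> borel_measurable borel" using assms by (simp add: bounded_borel_def)
  show ?thesis by (rule integrable_const_bound[where B=M]) (auto simp: M)
qed

lemma avg_bound:
  assumes h: "h > 0" and u: "u \<in> borel_measurable borel" and M: "\<And>x. \<bar>u x\<bar> \<le> M"
  shows "\<bar>avg h u x\<bar> \<le> M"
proof -
  interpret prob_space "uniform_measure lborel {0..h}" by (rule unif_prob[OF h])
  have b: "bounded_borel u" using u M by (auto simp: bounded_borel_def)
  note i = unif_integrable[OF h b, of x]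
  have "- M \<le> u y" "u y \<le> M" for y using M[of y] by auto
  then show ?thesis unfolding avg_eq_integral[OF h b] abs_le_iff
    using integral_ge_const[OF i, of "-M"] integral_le_const[OF i, of M] by fastforce
qed

lemma avg_local:
  assumes u: "\<And>a b. u integrable_on {a..b}" and x: "a \<le> x" and h: "h > 0"
  shows "avg h u x = (integral {a..x+h} u - integral {a..x} u) / h"
  unfolding avg_def
  using Henstock_Kurzweil_Integration.integral_combine[of a x "x+h" u] u x h by auto

lemma isCont_avg:
  assumes u: "\<And>a b. u integrable_on {a..b}" and h: "h > 0"
  shows "isCont (avg h u) x"
proof -
  have c: "continuous_on {x-1..x+1+h} (\<lambda>y. integral {x-1..y} u)"
    by (rule indefinite_integral_continuous_1[OF u])
  have "continuous_on {x-1<..<x+1} (\<lambda>y. (integral {x-1..y+h} u - integral {x-1..y} u) / h)"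
    by (intro continuous_intros continuous_on_compose2[OF c]) (use h in auto)
  then have "continuous_on {x-1<..<x+1} (avg h u)"
    by (rule continuous_on_eq) (use avg_local[OF u _ h, of "x-1"] in auto)
  then show ?thesis by (simp add: continuous_on_eq_continuous_at)
qed

lemma DERIV_avg:
  assumes u: "continuous_on UNIV u" and h: "h > 0"
  shows "DERIV (avg h u) x :> (u (x + h) - u x) / h"
proof -
  have int: "u integrable_on {a..b}" for a b
    by (rule integrable_continuous_real) (use u continuous_on_subset in blast)
  have D: "DERIV (\<lambda>y. integral {x-1..y} u) z :> u z" if "x - 1 < z" for z
  proof -
    have "((\<lambda>y. integral {x-1..y} u) has_real_derivative u z) (at z within {x-1..z+1})"
      by (rule integral_has_real_derivative) (use u that continuous_on_subset in auto)
    then show ?thesis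
      using that by (subst (asm) at_within_interior) (auto simp: interior_atLeastAtMost_real)
  qed
  have D1: "DERIV (\<lambda>y. integral {x-1..y+h} u) x :> u (x + h)"
    using D[of "x+h"] h DERIV_shift[of "\<lambda>y. integral {x-1..y} u" "u (x+h)" x h] by simp
  have "DERIV (\<lambda>y. (integral {x-1..y+h} u - integral {x-1..y} u) / h) x :> (u (x + h) - u x) / h"
    by (intro DERIV_cdivide DERIV_diff D1 D) simp
  then show ?thesis
    by (rule has_field_derivative_transform_within_open[of _ _ _ "{x-1<..}"])
       (use avg_local[OF int _ h, of "x-1"] in auto)
qed

text \<open>
Lebesgue's differentiation theorem: averaging is undone almost everywhere as the window shrinks.
\<close>

lemma avg_tendsto_AE:
  assumes u: "bounded_borel u" and e: "\<And>n. e n > 0" "e \<longlonglongrightarrow> 0"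
  shows "AE x in lborel. (\<lambda>n. avg (e n) u x) \<longlonglongrightarrow> u x"
proof -
  have int: "u integrable_on cbox a b" for a b
    using bounded_borel_integrable_on[OF u, of a b] by simp
  from integrable_ccontinuous_explicit[of u, OF int] obtain N where N: "negligible N"
    "\<And>x d. \<lbrakk>x \<notin> N; 0 < d\<rbrakk> \<Longrightarrow> \<exists>k>0. \<forall>h. 0 < h \<and> h < k \<longrightarrow>
        norm (integral (cbox x (x + h *\<^sub>R One)) u /\<^sub>R h ^ DIM(real) - u x) < d" by blast
  have lim: "(\<lambda>n. avg (e n) u x) \<longlonglongrightarrow> u x" if "x \<notin> N" for x
  proof (rule LIMSEQ_I)
    fix d :: real assume "d > 0"
    from N(2)[OF that this] obtain k where k: "k > 0"
      "\<And>h. 0 < h \<Longrightarrow> h < k \<Longrightarrow> \<bar>avg h u x - u x\<bar> < d"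
      by (auto simp: avg_def divide_inverse mult.commute)
    have "\<forall>\<^sub>F n in sequentially. e n < k" using e(2) k(1) by (rule order_tendstoD)
    then show "\<exists>no. \<forall>n\<ge>no. norm (avg (e n) u x - u x) < d"
      using k(2) e(1) by (auto simp: eventually_sequentially)
  qed
  have "N \<in> null_sets lebesgue" using N(1) negligible_iff_null_sets by blast
  then have "AE x in lebesgue. x \<notin> N" by (rule AE_not_in)
  then have "AE x in lebesgue. (\<lambda>n. avg (e n) u x) \<longlonglongrightarrow> u x"
    by (rule AE_mp) (auto intro!: AE_I2 lim)
  then show ?thesis by (simp add: AE_completion_iff)
qed

text \<open>
The scale on which each average gains one step: class \<open>0\<close> are the bounded Borel functions, class \<open>1\<close>
the bounded continuous ones, and class \<open>k + 1\<close> for \<open>k \<ge> 1\<close> those with bounded continuous derivatives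
up to order \<open>k\<close>. Class \<open>3\<close> is what the heat flow needs.
\<close>

fun smooth :: "nat \<Rightarrow> (real \<Rightarrow> real) \<Rightarrow> bool" where
  "smooth 0 u = bounded_borel u"
| "smooth (Suc 0) u = (bounded_borel u \<and> continuous_on UNIV u)"
| "smooth (Suc (Suc k)) u =
     (bounded_borel u \<and> (\<exists>u'. (\<forall>x. DERIV u x :> u' x) \<and> smooth (Suc k) u'))"

lemma smooth_bounded_borel: "smooth k u \<Longrightarrow> bounded_borel u"
  by (cases "(k, u)" rule: smooth.cases) auto

lemma smooth_continuous: "smooth (Suc k) u \<Longrightarrow> continuous_on UNIV u"
  by (cases k) (auto intro: continuous_at_imp_continuous_on DERIV_isCont)

lemma bounded_borel_avg:
  assumes "h > 0" "bounded_borel u" shows "bounded_borel (avg h u)" "continuous_on UNIV (avg h u)"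
proof -
  obtain M where M: "\<And>x. \<bar>u x\<bar> \<le> M" using assms by (auto simp: bounded_borel_def)
  have "isCont (avg h u) x" for x
    by (rule isCont_avg[OF bounded_borel_integrable_on[OF assms(2)] assms(1)])
  then show c: "continuous_on UNIV (avg h u)" by (simp add: continuous_at_imp_continuous_on)
  then show "bounded_borel (avg h u)"
    using avg_bound[OF assms(1) bounded_borelD[OF assms(2)] M] borel_measurable_continuous_onI[OF c]
    by (auto simp: bounded_borel_def)
qed

lemma bounded_borel_difference_quotient:
  assumes "h > 0" "bounded_borel u" shows "bounded_borel (\<lambda>x. (u (x + h) - u x) / h)"
proof -
  obtain M where M: "\<And>x. \<bar>u x\<bar> \<le> M" and [measurable]: "u \<in> borel_measurable borel"
    using assms(2) by (auto simp: bounded_borel_def)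
  have "\<bar>(u (x + h) - u x) / h\<bar> \<le> (M + M) / h" for x
    unfolding abs_divide using M[of x] M[of "x + h"] assms(1) by (intro frac_le) auto
  then show ?thesis by (auto simp: bounded_borel_def)
qed

lemma smooth_difference_quotient:
  "h > 0 \<Longrightarrow> smooth k u \<Longrightarrow> smooth k (\<lambda>x. (u (x + h) - u x) / h)"
proof (induction k u rule: smooth.induct)
  case (2 u)
  then have "continuous_on UNIV (\<lambda>x. (u (x + h) - u x) / h)"
    by (auto intro!: continuous_intros continuous_on_compose2[of UNIV u])
  with 2 show ?case by (simp add: bounded_borel_difference_quotient)
next
  case (3 k u)
  then obtain u' where u': "\<And>x. DERIV u x :> u' x" "smooth (Suc k) u'" by auto
  have "DERIV (\<lambda>x. (u (x + h) - u x) / h) x :> (u' (x + h) - u' x) / h" for x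
    by (intro DERIV_cdivide DERIV_diff u'(1)) (use u'(1) DERIV_shift in blast)
  with 3(1)[OF 3(2) u'(2)] 3 show ?case
    by (auto simp: bounded_borel_difference_quotient
        intro!: exI[of _ "\<lambda>x. (u' (x + h) - u' x) / h"])
qed (simp add: bounded_borel_difference_quotient)

text \<open>
The derivative of an average of a continuous function is a difference quotient of that function, so
it lies in the same class as the function itself.
\<close>

lemma smooth_avg:
  assumes h: "h > 0" and u: "smooth k u"
  shows "smooth (Suc k) (avg h u)"
proof (cases k)
  case 0
  then show ?thesis using bounded_borel_avg[OF h] u by simp
next
  case (Suc j)
  then have "smooth (Suc j) (\<lambda>x. (u (x + h) - u x) / h)"
    using smooth_difference_quotient[OF h] u by simp
  moreover have "DERIV (avg h u) x :> (u (x + h) - u x) / h" for x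
    by (rule DERIV_avg[OF _ h]) (use u Suc smooth_continuous in blast)
  ultimately show ?thesis using Suc bounded_borel_avg[OF h smooth_bounded_borel[OF u]]
    by (auto intro!: exI[of _ "\<lambda>x. (u (x + h) - u x) / h"])
qed

text \<open>
The pointwise bound \<open>u x + v y \<le> r (x + y)\<close> along each antidiagonal \<open>x + y = z\<close>, up to null sets:
the form in which an essential supremum provides it.
\<close>

definition ae_sum_le :: "(real \<Rightarrow> real) \<Rightarrow> (real \<Rightarrow> real) \<Rightarrow> (real \<Rightarrow> real) \<Rightarrow> bool" where
  "ae_sum_le u v r \<longleftrightarrow> (\<forall>z. AE y in lborel. u (z - y) + v y \<le> r z)"

lemma ae_sum_le_commute:
  assumes [measurable]: "u \<in> borel_measurable borel" "v \<in> borel_measurable borel"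
    and "ae_sum_le u v r"
  shows "ae_sum_le v u r"
  unfolding ae_sum_le_def
proof
  fix z
  have "AE y in lborel. u (z - (z + (-1) * y)) + v (z + (-1) * y) \<le> r z"
    by (rule AE_borel_affine[where P="\<lambda>y. u (z - y) + v y \<le> r z"])
       (use assms(3) in \<open>auto simp: ae_sum_le_def\<close>)
  then show "AE y in lborel. v (z - y) + u y \<le> r z"
    by (simp add: add.commute)
qed

text \<open>
Shifting \<open>u\<close> and \<open>r\<close> by the same amount preserves the bound, hence so does averaging over the shifts.
The exceptional null set depends on the shift; Fubini exchanges the two almost-everywhere quantifiers.
\<close>

lemma ae_sum_le_avg:
  assumes h: "h > 0" and u: "bounded_borel u" and v: "bounded_borel v" and r: "bounded_borel r"
    and le: "ae_sum_le u v r"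
  shows "ae_sum_le (avg h u) v (avg h r)"
  unfolding ae_sum_le_def
proof
  fix z
  have [measurable]: "u \<in> borel_measurable borel" "v \<in> borel_measurable borel" "r \<in> borel_measurable borel"
    using u v r by (auto simp: bounded_borel_def)
  interpret prob_space "uniform_measure lborel {0..h}" by (rule unif_prob[OF h])
  have "AE s in lborel. AE y in lborel. u (z + s - y) + v y \<le> r (z + s)"
    using le by (auto simp: ae_sum_le_def)
  then have "AE y in lborel. AE s in lborel. u (z + s - y) + v y \<le> r (z + s)"
    by (subst (asm) lborel_pair.AE_commute) measurable
  then show "AE y in lborel. avg h u (z - y) + v y \<le> avg h r z"
  proof (rule AE_mp, intro AE_I2 impI)
    fix y assume a: "AE s in lborel. u (z + s - y) + v y \<le> r (z + s)"
    have iu: "integrable (uniform_measure lborel {0..h}) (\<lambda>s. u (z - y + s))"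
      by (rule unif_integrable[OF h u])
    have "avg h u (z - y) + v y = (\<integral>s. u (z - y + s) + v y \<partial>uniform_measure lborel {0..h})"
      using iu prob_space by (simp add: avg_eq_integral[OF h u])
    also have "\<dots> \<le> (\<integral>s. r (z + s) \<partial>uniform_measure lborel {0..h})"
      by (rule integral_mono_AE) (use iu unif_integrable[OF h r, of z] unif_AE[OF a] in \<open>auto simp: algebra_simps\<close>)
    finally show "avg h u (z - y) + v y \<le> avg h r z" by (simp add: avg_eq_integral[OF h r])
  qed
qed

text \<open>
The set of \<open>t\<close> where the bound fails on an antidiagonal is open, and an open null set is empty.
\<close>

lemma ae_sum_le_continuous:
  assumes "continuous_on UNIV u" "continuous_on UNIV v" "ae_sum_le u v r"
  shows "u x + v y \<le> r (x + y)"
proof (rule ccontr)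
  assume not: "\<not> u x + v y \<le> r (x + y)"
  define S where "S = {t. u (x + y - t) + v t > r (x + y)}"
  have o: "open S" unfolding S_def
    by (intro open_Collect_less continuous_intros continuous_on_compose2[OF assms(1)]
        continuous_on_compose2[OF assms(2)]) auto
  have "y \<in> S" using not by (simp add: S_def)
  then have "S \<noteq> {}" by auto
  have "AE t in lborel. t \<notin> S" using assms(3) by (auto simp: ae_sum_le_def S_def not_less)
  then have "emeasure lborel S = 0"
    by (subst (asm) AE_iff_measurable[of S]) (use o in auto)
  then have "S \<in> null_sets lebesgue" using o by (auto simp: null_sets_def)
  then have "negligible S" by (simp add: negligible_iff_null_sets)
  then show False using open_not_negligible[OF o \<open>S \<noteq> {}\<close>] by simp
qed


section \<open>A maximum principle\<close>

lemma global_min_second_order: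
  fixes f f' :: "real \<Rightarrow> real"
  assumes d: "\<And>x. DERIV f x :> f' x" and dd: "DERIV f' x0 :> d"
    and min: "\<And>x. f x0 \<le> f x"
  shows "f' x0 = 0" "d \<ge> 0"
proof -
  show z: "f' x0 = 0"
    by (rule DERIV_local_min[OF d, of 1]) (use min in auto)
  show "d \<ge> 0"
  proof (rule ccontr)
    assume "\<not> d \<ge> 0"
    then obtain e where e: "e > 0" "\<And>h. 0 < h \<Longrightarrow> h < e \<Longrightarrow> f' (x0 + h) < 0"
      using DERIV_neg_dec_right[OF dd] z by auto
    have "f (x0 + e / 2) < f x0"
    proof (rule DERIV_neg_imp_decreasing_open[where f=f])
      show "\<exists>y. DERIV f x :> y \<and> y < 0" if "x0 < x" "x < x0 + e / 2" for x
        using d[of x] e(2)[of "x - x0"] e(1) that by auto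
      show "continuous_on {x0..x0 + e / 2} f"
        by (rule continuous_at_imp_continuous_on) (use d DERIV_isCont in blast)
    qed (use e in auto)
    then show False using min[of "x0 + e / 2"] by simp
  qed
qed

text \<open>
If \<open>F\<close> solves \<open>\<partial>\<^sub>s F = s / (2 \<alpha>) \<partial>\<^sub>x\<^sub>x F\<close> and \<open>\<Phi>' = exp (c - \<alpha> x\<^sup>2)\<close>, then \<open>U = \<Phi>\<^sup>-\<^sup>1 F\<close> solves the
equation below; the quadratic term comes from \<open>\<Phi>'' x = - 2 \<alpha> x \<Phi>' x\<close>. The parameter \<open>s\<close> is a
standard deviation, not a variance, which explains the factor \<open>s\<close> and makes the derivative exist at
\<open>s = 0\<close> as well. The functions \<open>Ux\<close> and \<open>Uxx\<close> are the spatial derivatives.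
\<close>

definition ehrhard_flow ::
    "real \<Rightarrow> real \<Rightarrow> (real \<Rightarrow> real \<Rightarrow> real) \<Rightarrow> (real \<Rightarrow> real \<Rightarrow> real) \<Rightarrow> (real \<Rightarrow> real \<Rightarrow> real) \<Rightarrow> bool" where
  "ehrhard_flow \<alpha> B U Ux Uxx \<longleftrightarrow>
     continuous_on UNIV (\<lambda>(s, x). U s x) \<and>
     (\<forall>s x. \<bar>U s x\<bar> \<le> B) \<and> (\<forall>s x. \<bar>Ux s x\<bar> \<le> B) \<and>
     (\<forall>s x. DERIV (U s) x :> Ux s x) \<and> (\<forall>s x. DERIV (Ux s) x :> Uxx s x) \<and>
     (\<forall>s x. DERIV (\<lambda>s. U s x) s :> s / (2 * \<alpha>) * (Uxx s x - 2 * \<alpha> * U s x * (Ux s x)\<^sup>2))"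

lemma ehrhard_flow_mono:
  "ehrhard_flow \<alpha> B U Ux Uxx \<Longrightarrow> B \<le> B' \<Longrightarrow> ehrhard_flow \<alpha> B' U Ux Uxx"
  unfolding ehrhard_flow_def by (meson order_trans)

text \<open>
Parabolic maximum principle for \<open>R s (x + y) - U s x - V s y\<close>. The penalty
\<open>\<eta> * exp (K * s) * (1 + x\<^sup>2 + y\<^sup>2)\<close> with arbitrary \<open>\<eta> > 0\<close> forces the minimum to be attained, and its growth in \<open>s\<close>
absorbs the errors that it causes in the spatial derivatives. At a nonpositive minimum the
spatial tests in the directions \<open>(1, 0)\<close>, \<open>(0, 1)\<close> and \<open>(1, -1)\<close> bound \<open>R'' - U'' - V''\<close> from below, the
first order conditions make the three slopes nearly equal, and together they contradict the
derivative in \<open>s\<close>.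
\<close>

lemma ehrhard_flow_comparison:
  assumes \<alpha>: "\<alpha> > 0"
    and U: "ehrhard_flow \<alpha> B U Ux Uxx" and V: "ehrhard_flow \<alpha> B V Vx Vxx"
    and R: "ehrhard_flow \<alpha> B R Rx Rxx"
    and init: "\<And>x y. U 0 x + V 0 y \<le> R 0 (x + y)"
    and s1: "0 \<le> s1" "s1 \<le> 1"
  shows "U s1 x1 + V s1 y1 \<le> R s1 (x1 + y1)"
proof -
  have U: "continuous_on UNIV (\<lambda>(s, x). U s x)"
    "\<And>s x. \<bar>U s x\<bar> \<le> B" "\<And>s x. \<bar>Ux s x\<bar> \<le> B"
    "\<And>s x. DERIV (U s) x :> Ux s x" "\<And>s x. DERIV (Ux s) x :> Uxx s x"
    "\<And>s x. DERIV (\<lambda>s. U s x) s :> s / (2 * \<alpha>) * (Uxx s x - 2 * \<alpha> * U s x * (Ux s x)\<^sup>2)"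
    using U unfolding ehrhard_flow_def by simp_all
  have V: "continuous_on UNIV (\<lambda>(s, x). V s x)"
    "\<And>s x. \<bar>V s x\<bar> \<le> B" "\<And>s x. \<bar>Vx s x\<bar> \<le> B"
    "\<And>s x. DERIV (V s) x :> Vx s x" "\<And>s x. DERIV (Vx s) x :> Vxx s x"
    "\<And>s x. DERIV (\<lambda>s. V s x) s :> s / (2 * \<alpha>) * (Vxx s x - 2 * \<alpha> * V s x * (Vx s x)\<^sup>2)"
    using V unfolding ehrhard_flow_def by simp_all
  have R: "continuous_on UNIV (\<lambda>(s, x). R s x)"
    "\<And>s x. \<bar>R s x\<bar> \<le> B" "\<And>s x. \<bar>Rx s x\<bar> \<le> B"
    "\<And>s x. DERIV (R s) x :> Rx s x" "\<And>s x. DERIV (Rx s) x :> Rxx s x"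
    "\<And>s x. DERIV (\<lambda>s. R s x) s :> s / (2 * \<alpha>) * (Rxx s x - 2 * \<alpha> * R s x * (Rx s x)\<^sup>2)"
    using R unfolding ehrhard_flow_def by simp_all
  have B0: "B \<ge> 0" using U(2)[of 0 0] by simp
  \<comment> \<open>the error terms below are at most \<open>(K - 1) * \<eta> * exp (K * s) * \<psi> x y\<close>; the additional \<open>1\<close> makes the inequality strict\<close>
  define K where "K = (4 + 16 * \<alpha> * B\<^sup>2) / (2 * \<alpha>) + 1"
  have K0: "K > 0" using \<alpha> by (simp add: K_def add_nonneg_pos)
  define \<psi> where "\<psi> x y = 1 + x\<^sup>2 + y\<^sup>2" for x y :: real
  have \<psi>: "\<psi> x y \<ge> 1" "\<bar>x\<bar> \<le> \<psi> x y" "\<bar>y\<bar> \<le> \<psi> x y" for x y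
  proof -
    have "\<bar>t\<bar> \<le> 1 + t\<^sup>2" for t :: real
      using zero_le_power2[of "\<bar>t\<bar> - 1"] zero_le_power2[of t] by (simp add: power2_diff)
    from this[of x] this[of y] show "\<psi> x y \<ge> 1" "\<bar>x\<bar> \<le> \<psi> x y" "\<bar>y\<bar> \<le> \<psi> x y"
      using zero_le_power2[of x] zero_le_power2[of y] unfolding \<psi>_def by linarith+
  qed
  define D where "D \<eta> s x y = R s (x + y) - U s x - V s y + \<eta> * exp (K * s) * \<psi> x y" for \<eta> s x y
  have pos: "D \<eta> s x y > 0" if \<eta>: "\<eta> > 0" and s: "0 \<le> s" "s \<le> 1" for \<eta> s x y
  proof (rule ccontr)
    assume neg: "\<not> D \<eta> s x y > 0"
    have contU: "continuous_on S (\<lambda>w. U (f w) (g w))"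
      if "continuous_on S f" "continuous_on S g" for f g and S :: "(real \<times> real \<times> real) set"
      using continuous_on_compose2[OF U(1) continuous_on_Pair[OF that]] by auto
    have contV: "continuous_on S (\<lambda>w. V (f w) (g w))"
      if "continuous_on S f" "continuous_on S g" for f g and S :: "(real \<times> real \<times> real) set"
      using continuous_on_compose2[OF V(1) continuous_on_Pair[OF that]] by auto
    have contR: "continuous_on S (\<lambda>w. R (f w) (g w))"
      if "continuous_on S f" "continuous_on S g" for f g and S :: "(real \<times> real \<times> real) set"
      using continuous_on_compose2[OF R(1) continuous_on_Pair[OF that]] by auto
    \<comment> \<open>beyond \<open>3 * B / \<eta>\<close> the penalty exceeds the bound \<open>3 * B\<close> on the other terms; the rest puts \<open>(x, y)\<close> into the box\<close>
    define \<rho> where "\<rho> = 3 * B / \<eta> + \<bar>x\<bar> + \<bar>y\<bar>"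
    have far: "D \<eta> t a b > 0" if "0 \<le> t" "\<bar>a\<bar> > \<rho> \<or> \<bar>b\<bar> > \<rho>" for t a b
    proof -
      have "3 * B / \<eta> \<le> \<rho>" by (simp add: \<rho>_def)
      then have "3 * B / \<eta> < \<psi> a b" using \<psi>(2)[of a b] \<psi>(3)[of b a] that(2) by linarith
      then have "3 * B < \<eta> * \<psi> a b" using \<eta> by (simp add: field_simps)
      also have "\<dots> \<le> \<eta> * exp (K * t) * \<psi> a b"
        using \<eta> K0 that(1) \<psi>(1)[of a b] by simp
      finally show ?thesis
        using U(2)[of t a] V(2)[of t b] R(2)[of t "a+b"] unfolding D_def by linarith
    qed
    define C where "C = {0..1::real} \<times> {-\<rho>..\<rho>} \<times> {-\<rho>..\<rho>}"
    have "\<bar>x\<bar> \<le> \<rho>" "\<bar>y\<bar> \<le> \<rho>" using B0 \<eta> by (simp_all add: \<rho>_def)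
    then have "(s, x, y) \<in> C" using s by (auto simp: C_def)
    moreover have "compact C" unfolding C_def by (intro compact_Times compact_Icc)
    moreover have "continuous_on C (\<lambda>w. D \<eta> (fst w) (fst (snd w)) (snd (snd w)))"
      unfolding D_def \<psi>_def
      by (intro continuous_intros contU contV contR)
    ultimately obtain w where w: "w \<in> C"
      "\<And>w'. w' \<in> C \<Longrightarrow> D \<eta> (fst w) (fst (snd w)) (snd (snd w)) \<le> D \<eta> (fst w') (fst (snd w')) (snd (snd w'))"
      using continuous_attains_inf[of C "\<lambda>w. D \<eta> (fst w) (fst (snd w)) (snd (snd w))"] by blast
    obtain t a b where tab: "w = (t, a, b)" by (cases w)
    have t: "0 \<le> t" "t \<le> 1" using w(1) by (auto simp: tab C_def)
    have minC: "D \<eta> t a b \<le> D \<eta> t' a' b'" if "(t', a', b') \<in> C" for t' a' b'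
      using w(2)[OF that] by (simp add: tab)
    have D0: "D \<eta> t a b \<le> 0" using minC[OF \<open>(s, x, y) \<in> C\<close>] neg by simp
    have min: "D \<eta> t a b \<le> D \<eta> t' a' b'" if "0 \<le> t'" "t' \<le> 1" for t' a' b'
    proof (cases "(t', a', b') \<in> C")
      case False
      then have "\<bar>a'\<bar> > \<rho> \<or> \<bar>b'\<bar> > \<rho>" using that by (auto simp: C_def)
      from far[OF that(1) this] D0 show ?thesis by linarith
    qed (rule minC)
    have "t \<noteq> 0"
    proof
      assume "t = 0"
      moreover have "\<eta> * \<psi> a b > 0" using \<eta> \<psi>(1)[of a b] by simp
      ultimately show False using D0 init[of a b] unfolding D_def by simp
    qed
    then have t0: "t > 0" using t by simp
    define e where "e = \<eta> * exp (K * t)"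
    have e0: "e > 0" using \<eta> by (simp add: e_def)
    define k where "k = Rx t (a + b)"
    have shift: "DERIV (\<lambda>x. R t (x + p)) z :> Rx t (z + p)" "DERIV (\<lambda>x. Rx t (x + p)) z :> Rxx t (z + p)"
      "DERIV (\<lambda>x. U t (x + p)) z :> Ux t (z + p)" "DERIV (\<lambda>x. Ux t (x + p)) z :> Uxx t (z + p)" for p z
      using R(4,5)[of t "z + p"] U(4,5)[of t "z + p"] by (simp_all add: DERIV_shift)
    have neg1: "DERIV (\<lambda>x. b - x) z :> -1" for z
      by (auto intro!: derivative_eq_intros)
    have reflect: "DERIV (\<lambda>x. V t (b - x)) z :> Vx t (b - z) * (-1)"
      "DERIV (\<lambda>x. - Vx t (b - x)) z :> - (Vxx t (b - z) * (-1))" for z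
      by (rule DERIV_chain2[OF V(4) neg1], rule DERIV_minus[OF DERIV_chain2[OF V(5) neg1]])
    have quad: "DERIV (\<lambda>x. e * (1 + x\<^sup>2 + q)) z :> 2 * e * z" for z q
      by (auto intro!: derivative_eq_intros)
    have lin: "DERIV (\<lambda>x. 2 * e * x) z :> 2 * e" for z
      by (auto intro!: derivative_eq_intros)
    \<comment> \<open>the spatial tests at the minimum: first along \<open>x\<close>, then along \<open>y\<close>, then along the antidiagonal, where \<open>R\<close> is constant\<close>
    have x1: "k - Ux t a + 2 * e * a = 0" and x2: "Rxx t (a + b) - Uxx t a + 2 * e \<ge> 0"
    proof -
      have d: "DERIV (\<lambda>x. R t (x + b) - U t x - V t b + e * (1 + x\<^sup>2 + b\<^sup>2)) x
          :> Rx t (x + b) - Ux t x - 0 + 2 * e * x" for x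
        by (rule DERIV_add[OF DERIV_diff[OF DERIV_diff[OF shift(1) U(4)] DERIV_const] quad])
      have dd: "DERIV (\<lambda>x. Rx t (x + b) - Ux t x - 0 + 2 * e * x) a
          :> Rxx t (a + b) - Uxx t a - 0 + 2 * e"
        by (rule DERIV_add[OF DERIV_diff[OF DERIV_diff[OF shift(2) U(5)] DERIV_const] lin])
      have m: "R t (a + b) - U t a - V t b + e * (1 + a\<^sup>2 + b\<^sup>2)
          \<le> R t (x + b) - U t x - V t b + e * (1 + x\<^sup>2 + b\<^sup>2)" for x
        using min[OF t, of x b] by (simp add: D_def e_def \<psi>_def)
      show "k - Ux t a + 2 * e * a = 0" "Rxx t (a + b) - Uxx t a + 2 * e \<ge> 0"
        using global_min_second_order[OF d dd m] by (simp_all add: k_def)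
    qed
    have y1: "k - Vx t b + 2 * e * b = 0" and y2: "Rxx t (a + b) - Vxx t b + 2 * e \<ge> 0"
    proof -
      have d: "DERIV (\<lambda>x. R t (x + a) - U t a - V t x + e * (1 + x\<^sup>2 + a\<^sup>2)) x
          :> Rx t (x + a) - 0 - Vx t x + 2 * e * x" for x
        by (rule DERIV_add[OF DERIV_diff[OF DERIV_diff[OF shift(1) DERIV_const] V(4)] quad])
      have dd: "DERIV (\<lambda>x. Rx t (x + a) - 0 - Vx t x + 2 * e * x) b
          :> Rxx t (b + a) - 0 - Vxx t b + 2 * e"
        by (rule DERIV_add[OF DERIV_diff[OF DERIV_diff[OF shift(2) DERIV_const] V(5)] lin])
      have m: "R t (b + a) - U t a - V t b + e * (1 + b\<^sup>2 + a\<^sup>2)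
          \<le> R t (x + a) - U t a - V t x + e * (1 + x\<^sup>2 + a\<^sup>2)" for x
        using min[OF t, of a x] by (simp add: D_def e_def \<psi>_def add_ac)
      show "k - Vx t b + 2 * e * b = 0" "Rxx t (a + b) - Vxx t b + 2 * e \<ge> 0"
        using global_min_second_order[OF d dd m] by (simp_all add: k_def add_ac)
    qed
    have xy: "- Uxx t a - Vxx t b + 4 * e \<ge> 0"
    proof -
      have q: "DERIV (\<lambda>x. e * (1 + (x + a)\<^sup>2 + (b - x)\<^sup>2)) x :> e * (2 * (x + a) - 2 * (b - x))" for x
        by (auto intro!: derivative_eq_intros)
      have q': "DERIV (\<lambda>x. e * (2 * (x + a) - 2 * (b - x))) x :> e * 4" for x
        by (auto intro!: derivative_eq_intros)
      have d: "DERIV (\<lambda>x. R t (a + b) - U t (x + a) - V t (b - x) + e * (1 + (x + a)\<^sup>2 + (b - x)\<^sup>2)) x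
          :> 0 - Ux t (x + a) - Vx t (b - x) * (-1) + e * (2 * (x + a) - 2 * (b - x))" for x
        by (rule DERIV_add[OF DERIV_diff[OF DERIV_diff[OF DERIV_const shift(3)] reflect(1)] q])
      have "DERIV (\<lambda>x. 0 - Ux t (x + a) + (- Vx t (b - x)) * (-1) + e * (2 * (x + a) - 2 * (b - x))) 0
          :> 0 - Uxx t (0 + a) + (- (Vxx t (b - 0) * (-1))) * (-1) + e * 4"
        by (rule DERIV_add[OF DERIV_add[OF DERIV_diff[OF DERIV_const shift(4)] DERIV_cmult_right[OF reflect(2)]] q'])
      then have dd: "DERIV (\<lambda>x. 0 - Ux t (x + a) - Vx t (b - x) * (-1) + e * (2 * (x + a) - 2 * (b - x))) 0
          :> - Uxx t a - Vxx t b + e * 4"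
        by simp
      have m: "R t (a + b) - U t (0 + a) - V t (b - 0) + e * (1 + (0 + a)\<^sup>2 + (b - 0)\<^sup>2)
          \<le> R t (a + b) - U t (x + a) - V t (b - x) + e * (1 + (x + a)\<^sup>2 + (b - x)\<^sup>2)" for x
        using min[OF t, of "x + a" "b - x"] by (simp add: D_def e_def \<psi>_def add_ac)
      show ?thesis using global_min_second_order(2)[OF d dd m] by simp
    qed
    \<comment> \<open>only \<open>s \<le> t\<close> is compared, so \<open>t = 1\<close> may be the end of the interval\<close>
    have time: "t / (2 * \<alpha>) * (Rxx t (a + b) - 2 * \<alpha> * R t (a + b) * k\<^sup>2)
        - t / (2 * \<alpha>) * (Uxx t a - 2 * \<alpha> * U t a * (Ux t a)\<^sup>2)
        - t / (2 * \<alpha>) * (Vxx t b - 2 * \<alpha> * V t b * (Vx t b)\<^sup>2) + e * K * \<psi> a b \<le> 0" (is "?dt \<le> 0")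
    proof (rule ccontr)
      assume "\<not> ?dt \<le> 0"
      moreover have "DERIV (\<lambda>s. \<eta> * exp (K * s) * \<psi> a b) t :> e * K * \<psi> a b"
        by (auto intro!: derivative_eq_intros simp: e_def)
      from DERIV_add[OF DERIV_diff[OF DERIV_diff[OF R(6) U(6)] V(6)] this, of "a + b" a b]
      have "DERIV (\<lambda>s. D \<eta> s a b) t :> ?dt"
        unfolding D_def k_def .
      ultimately obtain d where d: "d > 0" "\<And>h. h > 0 \<Longrightarrow> h < d \<Longrightarrow> D \<eta> (t - h) a b < D \<eta> t a b"
        using DERIV_pos_inc_left[of "\<lambda>s. D \<eta> s a b" ?dt t] unfolding not_le by blast
      have "min (d / 2) t > 0" "min (d / 2) t < d" using d(1) t0 by auto
      from d(2)[OF this] min[of "t - min (d / 2) t" a b] t show False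
        using \<open>min (d / 2) t > 0\<close> by auto
    qed
    have e\<psi>: "e * \<psi> a b > 0" using e0 \<psi>(1)[of a b] by (intro mult_pos_pos) auto
    have neg': "R t (a + b) - U t a - V t b \<le> 0"
      using D0 e\<psi> unfolding D_def e_def by linarith
    \<comment> \<open>replacing the slope \<open>p\<close> by the common slope \<open>k\<close> costs a multiple of the penalty\<close>
    have cross: "u * (k\<^sup>2 - p\<^sup>2) \<le> 4 * B\<^sup>2 * e * \<psi> a b"
      if "k - p + 2 * e * z = 0" "\<bar>u\<bar> \<le> B" "\<bar>p\<bar> \<le> B" "\<bar>z\<bar> \<le> \<psi> a b" for u p z
    proof -
      have "k - p = - (2 * e * z)" using that(1) by simp
      then have kp: "\<bar>k - p\<bar> = 2 * e * \<bar>z\<bar>" using e0 by (simp add: abs_mult)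
      have "\<bar>k\<bar> \<le> B" unfolding k_def by (rule R)
      then have k2: "\<bar>k + p\<bar> \<le> 2 * B" using that(3) by linarith
      have "u * (k\<^sup>2 - p\<^sup>2) = u * ((k - p) * (k + p))" by (simp add: power2_eq_square algebra_simps)
      also have "\<dots> \<le> \<bar>u\<bar> * (\<bar>k - p\<bar> * \<bar>k + p\<bar>)"
        by (metis abs_ge_self abs_mult)
      also have "\<dots> \<le> B * (2 * e * \<psi> a b * (2 * B))"
        unfolding kp by (intro mult_mono that k2) (use e0 B0 \<psi>(1)[of a b] in auto)
      finally show ?thesis by (simp add: power2_eq_square algebra_simps)
    qed
    have c1: "U t a * (k\<^sup>2 - (Ux t a)\<^sup>2) \<le> 4 * B\<^sup>2 * e * \<psi> a b"
      by (rule cross[OF x1 U(2,3) \<psi>(2)])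
    have c2: "V t b * (k\<^sup>2 - (Vx t b)\<^sup>2) \<le> 4 * B\<^sup>2 * e * \<psi> a b"
      by (rule cross[OF y1 V(2,3) \<psi>(3)])
    have c3: "(R t (a + b) - U t a - V t b) * k\<^sup>2 \<le> 0"
      using neg' by (simp add: mult_nonpos_nonneg)
    define L where "L = Rxx t (a + b) - Uxx t a - Vxx t b"
    define N where "N = R t (a + b) * k\<^sup>2 - U t a * (Ux t a)\<^sup>2 - V t b * (Vx t b)\<^sup>2"
    have "N \<le> 8 * B\<^sup>2 * e * \<psi> a b" using c1 c2 c3 unfolding N_def by (simp add: algebra_simps)
    then have N: "2 * \<alpha> * N \<le> 2 * \<alpha> * (8 * B\<^sup>2 * e * \<psi> a b)"
      by (rule mult_left_mono) (use \<alpha> in simp)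
    \<comment> \<open>the sum of the three second order tests is \<open>2 * L + 8 * e \<ge> 0\<close>\<close>
    have "L \<ge> - (4 * e)" using x2 y2 xy unfolding L_def by linarith
    also have "- (4 * e) \<ge> - (4 * e * \<psi> a b)" using e0 \<psi>(1)[of a b] by simp
    finally have "L - 2 * \<alpha> * N \<ge> - ((4 + 16 * \<alpha> * B\<^sup>2) * (e * \<psi> a b))"
      using N by (simp add: algebra_simps)
    then have "t / (2 * \<alpha>) * (L - 2 * \<alpha> * N) \<ge> t / (2 * \<alpha>) * (- ((4 + 16 * \<alpha> * B\<^sup>2) * (e * \<psi> a b)))"
      using t \<alpha> by (intro mult_left_mono) auto
    moreover have "t / (2 * \<alpha>) * ((4 + 16 * \<alpha> * B\<^sup>2) * (e * \<psi> a b))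
        \<le> 1 / (2 * \<alpha>) * ((4 + 16 * \<alpha> * B\<^sup>2) * (e * \<psi> a b))"
      using t \<alpha> e0 \<psi>(1)[of a b] by (intro mult_right_mono divide_right_mono) auto
    moreover have "1 / (2 * \<alpha>) * ((4 + 16 * \<alpha> * B\<^sup>2) * (e * \<psi> a b)) = (K - 1) * (e * \<psi> a b)"
      by (simp add: K_def)
    moreover have "?dt = t / (2 * \<alpha>) * (L - 2 * \<alpha> * N) + K * (e * \<psi> a b)"
      unfolding L_def N_def by (simp add: algebra_simps)
    ultimately have "e * \<psi> a b \<le> 0" using time by (simp add: algebra_simps)
    then show False using e\<psi> by simp
  qed
  have "U s1 x1 + V s1 y1 - R s1 (x1 + y1) \<le> 0 + \<epsilon>" if "\<epsilon> > 0" for \<epsilon>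
  proof -
    have p: "exp (K * s1) * \<psi> x1 y1 > 0" using \<psi>(1)[of x1 y1] by simp
    have "D (\<epsilon> / (exp (K * s1) * \<psi> x1 y1)) s1 x1 y1 > 0" by (rule pos) (use that p s1 in auto)
    then show ?thesis using \<psi>(1)[of x1 y1] unfolding D_def by (simp split: if_splits)
  qed
  then have "U s1 x1 + V s1 y1 - R s1 (x1 + y1) \<le> 0" by (rule field_le_epsilon)
  then show ?thesis by simp
qed


section \<open>The heat flow of a centered Gaussian\<close>

lemma DERIV_integral_dominated:
  fixes F F' :: "real \<Rightarrow> 'a \<Rightarrow> real"
  assumes D: "\<And>t z. DERIV (\<lambda>t. F t z) t :> F' t z"
    and B: "\<And>t z. \<bar>F' t z\<bar> \<le> B z" "integrable M B"
    and F: "\<And>t. integrable M (F t)" and F': "\<And>t. F' t \<in> borel_measurable M"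
  shows "DERIV (\<lambda>t. \<integral>z. F t z \<partial>M) t :> (\<integral>z. F' t z \<partial>M)"
  unfolding DERIV_def tendsto_at_iff_sequentially
proof (intro allI impI)
  fix X :: "nat \<Rightarrow> real" assume X: "\<forall>i. X i \<in> UNIV - {0}" "X \<longlonglongrightarrow> 0"
  have lim: "(\<lambda>n. \<integral>z. (F (t + X n) z - F t z) / X n \<partial>M) \<longlonglongrightarrow> (\<integral>z. F' t z \<partial>M)"
  proof (rule integral_dominated_convergence[where w=B])
    show "AE z in M. (\<lambda>n. (F (t + X n) z - F t z) / X n) \<longlonglongrightarrow> F' t z"
      using D[of _ t] X unfolding DERIV_def tendsto_at_iff_sequentially comp_def by (intro AE_I2) blast
    show "AE z in M. norm ((F (t + X n) z - F t z) / X n) \<le> B z" for n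
    proof (rule AE_I2)
      fix z
      have "norm (F (t + X n) z - F t z) \<le> B z * norm (t + X n - t)"
        by (rule field_differentiable_bound[of UNIV _ "\<lambda>t. F' t z"]) (use D B in auto)
      then show "norm ((F (t + X n) z - F t z) / X n) \<le> B z"
        using X(1) by (auto simp: divide_simps)
    qed
    show "(\<lambda>z. (F (t + X n) z - F t z) / X n) \<in> borel_measurable M" for n
      using F borel_measurable_integrable by measurable
  qed (fact B(2) F')+
  have "(\<integral>z. (F (t + X n) z - F t z) / X n \<partial>M) = ((\<integral>z. F (t + X n) z \<partial>M) - (\<integral>z. F t z \<partial>M)) / X n" for n
    by (simp only: integral_divide_zero Bochner_Integration.integral_diff[OF F F])
  from lim[unfolded this]
  show "((\<lambda>h. ((\<integral>z. F (t + h) z \<partial>M) - (\<integral>z. F t z \<partial>M)) / h) \<circ> X) \<longlonglongrightarrow> (\<integral>z. F' t z \<partial>M)"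
    unfolding comp_def .
qed

lemma integral_derivative_eq_0:
  fixes F f :: "real \<Rightarrow> real"
  assumes D: "\<And>x. DERIV F x :> f x" and cont: "continuous_on UNIV f" and int: "integrable lborel f"
    and lim: "(\<lambda>n. F (real n)) \<longlonglongrightarrow> 0" "(\<lambda>n. F (- real n)) \<longlonglongrightarrow> 0"
  shows "(\<integral>x. f x \<partial>lborel) = 0"
proof -
  have "(\<lambda>n. \<integral>x. f x * indicator {- real n..real n} x \<partial>lborel) \<longlonglongrightarrow> (\<integral>x. f x \<partial>lborel)"
  proof (rule integral_dominated_convergence[where w="\<lambda>x. norm (f x)"])
    show "AE x in lborel. (\<lambda>n. f x * indicator {- real n..real n} x) \<longlonglongrightarrow> f x"
    proof (rule AE_I2)
      fix x :: real
      obtain N where N: "\<bar>x\<bar> \<le> real N" using real_arch_simple by blast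
      have "f x * indicator {- real n..real n} x = f x" if "n \<ge> N" for n
        using N that by (auto simp: indicator_def abs_le_iff)
      then show "(\<lambda>n. f x * indicator {- real n..real n} x) \<longlonglongrightarrow> f x"
        by (intro tendsto_eventually) (auto simp: eventually_sequentially)
    qed
    show "AE x in lborel. norm (f x * indicator {- real n..real n} x) \<le> norm (f x)" for n
      by (auto simp: indicator_def)
    show "(\<lambda>x. f x * indicator {- real n..real n} x) \<in> borel_measurable lborel" for n
      using borel_measurable_integrable[OF int] by measurable
  qed (use int in auto)
  moreover have "(\<integral>x. f x * indicator {- real n..real n} x \<partial>lborel) = F (real n) - F (- real n)" for n
    by (rule integral_FTC_Icc_real) (use D cont in \<open>auto simp: continuous_on_eq_continuous_at\<close>)
  ultimately have "(\<lambda>n. F (real n) - F (- real n)) \<longlonglongrightarrow> (\<integral>x. f x \<partial>lborel)" by simp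
  moreover have "(\<lambda>n. F (real n) - F (- real n)) \<longlonglongrightarrow> 0 - 0" by (intro tendsto_diff lim)
  ultimately show ?thesis using LIMSEQ_unique by fastforce
qed

text \<open>
The first moment is what dominates the derivative of \<open>p (x + s * z)\<close> in \<open>s\<close>.
\<close>

locale centered_gaussian = positive_density \<mu> "\<lambda>x. exp (c - \<alpha> * x\<^sup>2)" for \<mu> \<alpha> c +
  assumes \<alpha>: "\<alpha> > 0" and first_moment: "integrable \<mu> (\<lambda>x. x)"
begin

abbreviation \<phi> where "\<phi> x \<equiv> exp (c - \<alpha> * x\<^sup>2)"

lemma DERIV_\<phi>: "DERIV (\<lambda>x. \<phi> x) x :> - 2 * \<alpha> * x * \<phi> x"
  by (auto intro!: derivative_eq_intros)

lemma \<phi>_tendsto_0: "(\<lambda>n. \<phi> (real n)) \<longlonglongrightarrow> 0" "(\<lambda>n. \<phi> (- real n)) \<longlonglongrightarrow> 0"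
proof -
  have "filterlim (\<lambda>n. \<alpha> * (real n)\<^sup>2) at_top sequentially"
    by (intro filterlim_tendsto_pos_mult_at_top[OF tendsto_const \<alpha>] filterlim_pow_at_top
        filterlim_real_sequentially) simp
  then have "filterlim (\<lambda>n. - (\<alpha> * (real n)\<^sup>2)) at_bot sequentially"
    by (simp add: filterlim_uminus_at_top)
  then have "(\<lambda>n. exp (- (\<alpha> * (real n)\<^sup>2))) \<longlonglongrightarrow> 0"
    by (rule filterlim_compose[OF exp_at_bot])
  then have "(\<lambda>n. exp c * exp (- (\<alpha> * (real n)\<^sup>2))) \<longlonglongrightarrow> 0"
    by (rule tendsto_mult_right_zero)
  then show "(\<lambda>n. \<phi> (real n)) \<longlonglongrightarrow> 0" "(\<lambda>n. \<phi> (- real n)) \<longlonglongrightarrow> 0"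
    by (simp_all add: exp_diff exp_minus divide_inverse)
qed

text \<open>
\<open>q' z - 2 * \<alpha> * z * q z\<close> times the density is the derivative of \<open>q z * \<phi> z\<close>, which vanishes at both
ends of the line.
\<close>

lemma gaussian_integration_by_parts:
  assumes q: "\<And>x. DERIV q x :> q' x" "continuous_on UNIV q'"
    and B: "\<And>x. \<bar>q x\<bar> \<le> B" "\<And>x. \<bar>q' x\<bar> \<le> B"
  shows "2 * \<alpha> * (\<integral>z. z * q z \<partial>\<mu>) = (\<integral>z. q' z \<partial>\<mu>)"
proof -
  have cq: "continuous_on UNIV q" by (auto intro!: continuous_at_imp_continuous_on DERIV_isCont[OF q(1)])
  have [measurable]: "q \<in> borel_measurable borel" "q' \<in> borel_measurable borel"
    using cq q(2) borel_measurable_continuous_onI by auto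
  have iq': "integrable \<mu> q'" by (rule integrable_bounded[OF _ B(2)]) simp
  have izq: "integrable \<mu> (\<lambda>z. z * q z)"
  proof (rule Bochner_Integration.integrable_bound[of _ "\<lambda>z. B * z"])
    show "AE z in \<mu>. norm (z * q z) \<le> norm (B * z)"
    proof (rule AE_I2)
      fix z
      have "0 \<le> B" using B(1)[of 0] by simp
      then show "norm (z * q z) \<le> norm (B * z)"
        using mult_right_mono[OF B(1)[of z], of "\<bar>z\<bar>"] by (simp add: abs_mult mult.commute)
    qed
    show "integrable \<mu> (\<lambda>z. B * z)" using first_moment by simp
    show "(\<lambda>z. z * q z) \<in> borel_measurable \<mu>" by measurable
  qed
  define f where "f z = \<phi> z * (q' z - 2 * \<alpha> * (z * q z))" for z
  have i: "integrable \<mu> (\<lambda>z. q' z - 2 * \<alpha> * (z * q z))"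
    using iq' izq by simp
  have 0: "(\<integral>z. f z \<partial>lborel) = 0"
  proof (rule integral_derivative_eq_0[where F="\<lambda>z. q z * \<phi> z"])
    show "DERIV (\<lambda>z. q z * \<phi> z) z :> f z" for z
      using DERIV_mult[OF q(1) DERIV_\<phi>, of z] by (simp add: f_def algebra_simps)
    show "continuous_on UNIV f"
      unfolding f_def by (intro continuous_intros cq q(2))
    show "integrable lborel f"
      using i unfolding f_def by (subst (asm) integrable_mu_iff) auto
    have b: "norm (q z * \<phi> z) \<le> norm (\<phi> z) * B" for z
      using B(1)[of z] by (simp add: abs_mult mult.commute)
    show "(\<lambda>n. q (real n) * \<phi> (real n)) \<longlonglongrightarrow> 0"
      by (rule tendsto_0_le[OF \<phi>_tendsto_0(1)]) (rule always_eventually, rule allI, rule b)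
    show "(\<lambda>n. q (- real n) * \<phi> (- real n)) \<longlonglongrightarrow> 0"
      by (rule tendsto_0_le[OF \<phi>_tendsto_0(2)]) (rule always_eventually, rule allI, rule b)
  qed
  have "(\<integral>z. q' z - 2 * \<alpha> * (z * q z) \<partial>\<mu>) = 0"
    using 0 unfolding f_def by (subst integral_mu) auto
  then show ?thesis using iq' izq by simp
qed

text \<open>
Differentiating in \<open>s\<close> produces a factor \<open>z\<close>, and integration by parts trades it for one more spatial
derivative and a factor \<open>s / (2 * \<alpha>)\<close>.
\<close>

lemma heat_flow:
  assumes p: "\<And>x. DERIV p x :> p' x" "\<And>x. DERIV p' x :> p'' x" "continuous_on UNIV p''"
    and B: "\<And>x. \<bar>p x\<bar> \<le> B" "\<And>x. \<bar>p' x\<bar> \<le> B" "\<And>x. \<bar>p'' x\<bar> \<le> B"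
  shows "continuous_on UNIV (\<lambda>(s, x). \<integral>z. p (x + s * z) \<partial>\<mu>)"
    and "DERIV (\<lambda>x. \<integral>z. p (x + s * z) \<partial>\<mu>) x :> (\<integral>z. p' (x + s * z) \<partial>\<mu>)"
    and "DERIV (\<lambda>x. \<integral>z. p' (x + s * z) \<partial>\<mu>) x :> (\<integral>z. p'' (x + s * z) \<partial>\<mu>)"
    and "DERIV (\<lambda>s. \<integral>z. p (x + s * z) \<partial>\<mu>) s :> s / (2 * \<alpha>) * (\<integral>z. p'' (x + s * z) \<partial>\<mu>)"
proof -
  have c: "continuous_on UNIV p" "continuous_on UNIV p'"
    by (auto intro!: continuous_at_imp_continuous_on DERIV_isCont[OF p(1)] DERIV_isCont[OF p(2)])
  have [measurable]: "p \<in> borel_measurable borel" "p' \<in> borel_measurable borel" "p'' \<in> borel_measurable borel"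
    using c p(3) borel_measurable_continuous_onI by auto
  have int: "integrable \<mu> (\<lambda>z. p (x + s * z))" "integrable \<mu> (\<lambda>z. p' (x + s * z))" for x s
    by (rule integrable_bounded[OF _ B(1)], simp, rule integrable_bounded[OF _ B(2)], simp)
  show "continuous_on UNIV (\<lambda>(s, x). \<integral>z. p (x + s * z) \<partial>\<mu>)"
    unfolding continuous_on_sequentially comp_def
  proof (intro ballI allI impI, elim conjE)
    fix X :: "nat \<Rightarrow> real \<times> real" and a assume X: "X \<longlonglongrightarrow> a"
    have "(\<lambda>n. \<integral>z. p (snd (X n) + fst (X n) * z) \<partial>\<mu>) \<longlonglongrightarrow> (\<integral>z. p (snd a + fst a * z) \<partial>\<mu>)"
    proof (rule integral_dominated_convergence[where w="\<lambda>_. B"])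
      show "AE z in \<mu>. (\<lambda>n. p (snd (X n) + fst (X n) * z)) \<longlonglongrightarrow> p (snd a + fst a * z)"
        by (intro AE_I2 continuous_on_tendsto_compose[OF c(1)] tendsto_intros X) auto
      show "AE z in \<mu>. norm (p (snd (X n) + fst (X n) * z)) \<le> B" for n
        using B(1) by simp
      show "(\<lambda>z. p (snd a + fst a * z)) \<in> borel_measurable \<mu>"
        "(\<lambda>z. p (snd (X n) + fst (X n) * z)) \<in> borel_measurable \<mu>" for n
        by measurable
    qed simp
    then show "(\<lambda>n. case X n of (s, x) \<Rightarrow> \<integral>z. p (x + s * z) \<partial>\<mu>) \<longlonglongrightarrow> (case a of (s, x) \<Rightarrow> \<integral>z. p (x + s * z) \<partial>\<mu>)"
      by (simp add: case_prod_beta)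
  qed
  have shift: "DERIV (\<lambda>x. p (x + s * z)) x :> p' (x + s * z)"
    "DERIV (\<lambda>x. p' (x + s * z)) x :> p'' (x + s * z)" for s z x
    using p(1,2)[of "x + s * z"] by (simp_all add: DERIV_shift)
  show "DERIV (\<lambda>x. \<integral>z. p (x + s * z) \<partial>\<mu>) x :> (\<integral>z. p' (x + s * z) \<partial>\<mu>)"
    by (rule DERIV_integral_dominated[where B="\<lambda>_. B", OF shift(1) B(2) _ int(1)]) simp_all
  show "DERIV (\<lambda>x. \<integral>z. p' (x + s * z) \<partial>\<mu>) x :> (\<integral>z. p'' (x + s * z) \<partial>\<mu>)"
    by (rule DERIV_integral_dominated[where B="\<lambda>_. B", OF shift(2) B(3) _ int(2)]) simp_all
  have scale: "DERIV (\<lambda>z. x + s * z) z :> s" and scale': "DERIV (\<lambda>s. x + s * z) s :> z" for x s z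
    by (auto intro!: derivative_eq_intros)
  have ds: "DERIV (\<lambda>s. \<integral>z. p (x + s * z) \<partial>\<mu>) s :> (\<integral>z. p' (x + s * z) * z \<partial>\<mu>)"
  proof (rule DERIV_integral_dominated[where B="\<lambda>z. B * \<bar>z\<bar>"])
    show "DERIV (\<lambda>s. p (x + s * z)) s :> p' (x + s * z) * z" for s z
      by (rule DERIV_chain2[OF p(1) scale'])
    show "\<bar>p' (x + t * z) * z\<bar> \<le> B * \<bar>z\<bar>" for t z
      unfolding abs_mult by (rule mult_right_mono[OF B(2)]) simp
    show "integrable \<mu> (\<lambda>z. B * \<bar>z\<bar>)" using first_moment by simp
    show "integrable \<mu> (\<lambda>z. p (x + t * z))" for t by (rule int)
    show "(\<lambda>z. p' (x + t * z) * z) \<in> borel_measurable \<mu>" for t by measurable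
  qed
  have "2 * \<alpha> * (\<integral>z. z * p' (x + s * z) \<partial>\<mu>) = (\<integral>z. p'' (x + s * z) * s \<partial>\<mu>)"
  proof (rule gaussian_integration_by_parts[where B="B + B * \<bar>s\<bar>"])
    show "DERIV (\<lambda>z. p' (x + s * z)) z :> p'' (x + s * z) * s" for z
      by (rule DERIV_chain2[OF p(2) scale])
    show "continuous_on UNIV (\<lambda>z. p'' (x + s * z) * s)"
      by (intro continuous_intros continuous_on_compose2[OF p(3)]) auto
    have "0 \<le> B" using B(1)[of 0] by simp
    then show "\<bar>p' (x + s * z)\<bar> \<le> B + B * \<bar>s\<bar>" for z
      using B(2)[of "x + s * z"] by (simp add: add_increasing2)
    show "\<bar>p'' (x + s * z) * s\<bar> \<le> B + B * \<bar>s\<bar>" for z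
      using mult_right_mono[OF B(3)[of "x + s * z"], of "\<bar>s\<bar>"] \<open>0 \<le> B\<close> by (simp add: abs_mult)
  qed
  then have "(\<integral>z. p' (x + s * z) * z \<partial>\<mu>) = s / (2 * \<alpha>) * (\<integral>z. p'' (x + s * z) \<partial>\<mu>)"
    using \<alpha> by (simp add: field_simps)
  from ds[unfolded this]
  show "DERIV (\<lambda>s. \<integral>z. p (x + s * z) \<partial>\<mu>) s :> s / (2 * \<alpha>) * (\<integral>z. p'' (x + s * z) \<partial>\<mu>)" .
qed

text \<open>
The chain rule turns the heat equation for the mean of \<open>\<Phi> u\<close> into the flow equation for its image
under the inverse. All values stay in \<open>[- M, M]\<close>, where the density is bounded below, and this bounds
the spatial derivative.
\<close>

lemma ehrhard_flow_exists:
  assumes u: "smooth (Suc (Suc (Suc 0))) u"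
  shows "\<exists>B Ux Uxx. ehrhard_flow \<alpha> B (\<lambda>s x. Q (\<integral>z. cdf \<mu> (u (x + s * z)) \<partial>\<mu>)) Ux Uxx"
proof -
  obtain u' u'' where u': "\<And>x. DERIV u x :> u' x" and u'': "\<And>x. DERIV u' x :> u'' x"
    and cu'': "continuous_on UNIV u''" and b: "bounded_borel u" "bounded_borel u'" "bounded_borel u''"
    using u by auto
  obtain M0 M1 M2 where "\<And>x. \<bar>u x\<bar> \<le> M0" "\<And>x. \<bar>u' x\<bar> \<le> M1" "\<And>x. \<bar>u'' x\<bar> \<le> M2"
    using b unfolding bounded_borel_def by blast
  then have M: "\<bar>u x\<bar> \<le> max M0 (max M1 M2)" "\<bar>u' x\<bar> \<le> max M0 (max M1 M2)"
    "\<bar>u'' x\<bar> \<le> max M0 (max M1 M2)" for x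
    by (simp_all add: le_max_iff_disj)
  define M where "M = max M0 (max M1 M2)"
  note M = M[folded M_def]
  have M0: "M \<ge> 0" using M(1)[of 0] by simp
  have [measurable]: "u \<in> borel_measurable borel" using b(1) by (rule bounded_borelD)
  have cu: "continuous_on UNIV u" "continuous_on UNIV u'"
    by (auto intro!: continuous_at_imp_continuous_on DERIV_isCont[OF u'] DERIV_isCont[OF u''])
  define p where "p x = cdf \<mu> (u x)" for x
  define p' where "p' x = \<phi> (u x) * u' x" for x
  define p'' where "p'' x = (- 2 * \<alpha> * u x * \<phi> (u x) * u' x) * u' x + u'' x * \<phi> (u x)" for x
  have p: "DERIV p x :> p' x" for x
    unfolding p_def p'_def by (rule DERIV_chain2[OF DERIV_cdf u'])
  have p': "DERIV p' x :> p'' x" for x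
    unfolding p'_def p''_def by (rule DERIV_mult[OF DERIV_chain2[OF DERIV_\<phi> u'] u''])
  have p'': "continuous_on UNIV p''"
    unfolding p''_def by (intro continuous_intros cu cu'')
  define E where "E = exp c"
  have E: "0 < \<phi> t" "\<phi> t \<le> E" for t using \<alpha> by (simp_all add: E_def)
  define B where "B = 1 + E * M + (2 * \<alpha> * M * E * M * M + M * E)"
  have nn: "0 \<le> E" "0 \<le> E * M" "0 \<le> 2 * \<alpha> * M * E * M * M + M * E"
    using \<alpha> M0 by (simp_all add: E_def)
  have B: "\<bar>p x\<bar> \<le> B" "\<bar>p' x\<bar> \<le> B" "\<bar>p'' x\<bar> \<le> B" for x
  proof -
    show "\<bar>p x\<bar> \<le> B"
      using cdf_pos[of "u x"] cdf_less_1[of "u x"] nn unfolding p_def B_def by linarith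
    have "\<bar>p' x\<bar> \<le> E * M"
      unfolding p'_def abs_mult by (intro mult_mono M) (use E[of "u x"] nn in auto)
    then show "\<bar>p' x\<bar> \<le> B" using nn unfolding B_def by linarith
    have "\<bar>(- 2 * \<alpha> * u x * \<phi> (u x) * u' x) * u' x\<bar> \<le> 2 * \<alpha> * M * E * M * M"
      unfolding abs_mult by (intro mult_mono M) (use E[of "u x"] nn \<alpha> M0 in auto)
    moreover have "\<bar>u'' x * \<phi> (u x)\<bar> \<le> M * E"
      unfolding abs_mult by (intro mult_mono M) (use E[of "u x"] nn M0 in auto)
    ultimately have "\<bar>p'' x\<bar> \<le> 2 * \<alpha> * M * E * M * M + M * E"
      unfolding p''_def by linarith
    then show "\<bar>p'' x\<bar> \<le> B" using nn unfolding B_def by linarith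
  qed
  note heat = heat_flow[OF p p' p'' B]
  define F Fx Fxx where F_def: "F = (\<lambda>s x. \<integral>z. p (x + s * z) \<partial>\<mu>)"
    and Fx_def: "Fx = (\<lambda>s x. \<integral>z. p' (x + s * z) \<partial>\<mu>)"
    and Fxx_def: "Fxx = (\<lambda>s x. \<integral>z. p'' (x + s * z) \<partial>\<mu>)"
  have F: "continuous_on UNIV (\<lambda>(s, x). F s x)" "DERIV (F s) x :> Fx s x" "DERIV (Fx s) x :> Fxx s x"
    "DERIV (\<lambda>s. F s x) s :> s / (2 * \<alpha>) * Fxx s x" for s x
    using heat unfolding F_def Fx_def Fxx_def by blast+
  have Fb: "cdf \<mu> (-M) \<le> F s x" "F s x \<le> cdf \<mu> M" for s x
    unfolding F_def p_def using mean_cdf_bounds[of "\<lambda>z. u (x + s * z)" M] M(1) by auto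
  have F01: "0 < F s x" "F s x < 1" for s x
    using Fb[of s x] cdf_pos[of "-M"] cdf_less_1[of M] by linarith+
  have Fxb: "\<bar>Fx s x\<bar> \<le> B" for s x
  proof -
    have [measurable]: "p' \<in> borel_measurable borel"
      by (rule borel_measurable_continuous_onI) (auto intro!: continuous_at_imp_continuous_on DERIV_isCont[OF p'])
    have i: "integrable \<mu> (\<lambda>z. p' (x + s * z))" by (rule integrable_bounded[OF _ B(2)]) measurable
    have "- B \<le> p' y" "p' y \<le> B" for y using B(2)[of y] by auto
    then show ?thesis unfolding Fx_def abs_le_iff
      using integral_ge_const[OF i, of "-B"] integral_le_const[OF i, of B] by fastforce
  qed
  define U where "U s x = Q (F s x)" for s x
  define Ux where "Ux s x = 1 / \<phi> (U s x) * Fx s x" for s x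
  define Uxx where "Uxx s x = Fxx s x / \<phi> (U s x) + 2 * \<alpha> * U s x * (Ux s x)\<^sup>2" for s x
  have Ub: "\<bar>U s x\<bar> \<le> M" for s x
    using Fb[of s x] F01[of s x] le_Q_iff[of "F s x" "-M"] Q_le_iff[of "F s x" M]
    by (simp add: U_def abs_le_iff)
  have Uxd: "DERIV (U s) x :> Ux s x" for s x
    unfolding U_def Ux_def by (rule DERIV_chain2[OF DERIV_Q[OF F01] F(2)])
  have Uxxd: "DERIV (Ux s) x :> Uxx s x" for s x
  proof -
    have d: "DERIV (\<lambda>x. \<phi> (U s x)) x :> - 2 * \<alpha> * U s x * \<phi> (U s x) * Ux s x"
      by (rule DERIV_chain2[OF DERIV_\<phi> Uxd])
    have "DERIV (\<lambda>x. Fx s x / \<phi> (U s x)) x :>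
        (Fxx s x * \<phi> (U s x) - Fx s x * (- 2 * \<alpha> * U s x * \<phi> (U s x) * Ux s x)) / (\<phi> (U s x) * \<phi> (U s x))"
      by (rule DERIV_divide[OF F(3) d]) simp
    moreover have "(A * w - f * (- 2 * \<alpha> * y * w * k)) / (w * w) = A / w + 2 * \<alpha> * y * k\<^sup>2"
      if "w \<noteq> 0" "k = 1 / w * f" for w f k y A
      using that by (simp add: field_simps power2_eq_square)
    from this[OF _ Ux_def]
    have "(Fxx s x * \<phi> (U s x) - Fx s x * (- 2 * \<alpha> * U s x * \<phi> (U s x) * Ux s x)) / (\<phi> (U s x) * \<phi> (U s x))
        = Uxx s x"
      unfolding Uxx_def by simp
    moreover have "Ux s = (\<lambda>x. Fx s x / \<phi> (U s x))" by (simp add: Ux_def fun_eq_iff)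
    ultimately show ?thesis by simp
  qed
  have Us: "DERIV (\<lambda>s. U s x) s :> s / (2 * \<alpha>) * (Uxx s x - 2 * \<alpha> * U s x * (Ux s x)\<^sup>2)" for s x
  proof -
    have "DERIV (\<lambda>s. U s x) s :> 1 / \<phi> (U s x) * (s / (2 * \<alpha>) * Fxx s x)"
      unfolding U_def by (rule DERIV_chain2[OF DERIV_Q[OF F01] F(4)])
    moreover have "1 / \<phi> (U s x) * (s / (2 * \<alpha>) * Fxx s x) = s / (2 * \<alpha>) * (Uxx s x - 2 * \<alpha> * U s x * (Ux s x)\<^sup>2)"
      unfolding Uxx_def by simp
    ultimately show ?thesis by simp
  qed
  have cU: "continuous_on UNIV (\<lambda>(s, x). U s x)"
  proof -
    have "continuous_on UNIV (\<lambda>w. Q (case w of (s, x) \<Rightarrow> F s x))"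
      by (rule continuous_on_compose2[OF continuous_Q F(1)]) (use F01 in auto)
    then show ?thesis by (simp add: U_def case_prod_beta)
  qed
  \<comment> \<open>one constant that bounds both the flow and its slope\<close>
  define K where "K = M + B / exp (c - \<alpha> * M\<^sup>2)"
  have "0 \<le> B" using B(1)[of 0] by simp
  have UK: "\<bar>U s x\<bar> \<le> K" for s x
    using Ub[of s x] \<open>0 \<le> B\<close> unfolding K_def by (simp add: add_increasing2)
  have UxK: "\<bar>Ux s x\<bar> \<le> K" for s x
  proof -
    have "(U s x)\<^sup>2 \<le> M\<^sup>2" using Ub[of s x] M0 by (simp add: abs_le_square_iff[symmetric])
    then have "exp (c - \<alpha> * M\<^sup>2) \<le> \<phi> (U s x)" using \<alpha> by simp
    then have "\<bar>Fx s x\<bar> / \<phi> (U s x) \<le> B / exp (c - \<alpha> * M\<^sup>2)"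
      using Fxb[of s x] \<open>0 \<le> B\<close> by (intro frac_le) auto
    then show ?thesis using M0 unfolding K_def Ux_def by (simp add: abs_mult)
  qed
  have "ehrhard_flow \<alpha> K U Ux Uxx"
    unfolding ehrhard_flow_def using cU UK UxK Uxd Uxxd Us by blast
  then show ?thesis unfolding U_def[abs_def] F_def p_def by blast
qed

definition ehrhard_ineq :: "(real \<Rightarrow> real) \<Rightarrow> (real \<Rightarrow> real) \<Rightarrow> (real \<Rightarrow> real) \<Rightarrow> bool" where
  "ehrhard_ineq u v r \<longleftrightarrow>
     Q (\<integral>x. cdf \<mu> (u x) \<partial>\<mu>) + Q (\<integral>x. cdf \<mu> (v x) \<partial>\<mu>) \<le> Q (\<integral>x. cdf \<mu> (r x) \<partial>\<mu>)"

lemma ehrhard_ineq_smooth: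
  assumes u: "smooth (Suc (Suc (Suc 0))) u" and v: "smooth (Suc (Suc (Suc 0))) v"
    and r: "smooth (Suc (Suc (Suc 0))) r" and le: "ae_sum_le u v r"
  shows "ehrhard_ineq u v r"
proof -
  have le': "u x + v y \<le> r (x + y)" for x y
    by (rule ae_sum_le_continuous[OF smooth_continuous[OF u] smooth_continuous[OF v] le])
  let ?U = "\<lambda>u s x. Q (\<integral>z. cdf \<mu> (u (x + s * z)) \<partial>\<mu>)"
  obtain B1 Ux Uxx where "ehrhard_flow \<alpha> B1 (?U u) Ux Uxx" using ehrhard_flow_exists[OF u] by blast
  moreover obtain B2 Vx Vxx where "ehrhard_flow \<alpha> B2 (?U v) Vx Vxx" using ehrhard_flow_exists[OF v] by blast
  moreover obtain B3 Rx Rxx where "ehrhard_flow \<alpha> B3 (?U r) Rx Rxx" using ehrhard_flow_exists[OF r] by blast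
  ultimately have fl: "ehrhard_flow \<alpha> (max B1 (max B2 B3)) (?U u) Ux Uxx"
      "ehrhard_flow \<alpha> (max B1 (max B2 B3)) (?U v) Vx Vxx"
      "ehrhard_flow \<alpha> (max B1 (max B2 B3)) (?U r) Rx Rxx"
    by (auto elim!: ehrhard_flow_mono)
  have "?U u 1 0 + ?U v 1 0 \<le> ?U r 1 (0 + 0)"
    by (rule ehrhard_flow_comparison[OF \<alpha> fl]) (use le' prob_space in auto)
  then show ?thesis by (simp add: ehrhard_ineq_def)
qed

end


section \<open>The functional inequality for a centered Gaussian\<close>

text \<open>
The essential supremum of \<open>G x\<close> exceeds \<open>c\<close> exactly if the superlevel set \<open>{y. c < G x y}\<close> has
positive measure. That set is a section of a Borel set in the plane, and the measure of such a
section depends measurably on \<open>x\<close>.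
\<close>

lemma borel_measurable_esssup:
  fixes G :: "real \<Rightarrow> real \<Rightarrow> ennreal"
  assumes [measurable]: "(\<lambda>(x, y). G x y) \<in> borel_measurable (borel \<Otimes>\<^sub>M borel)"
  shows "(\<lambda>x. esssup lborel (G x)) \<in> borel_measurable borel"
proof (rule borel_measurableI_greater)
  fix c
  have [measurable]: "G x \<in> borel_measurable borel" for x by measurable
  have eq: "c < esssup lborel (G x) \<longleftrightarrow> (\<integral>\<^sup>+ y. indicator {w. c < G x w} y \<partial>lborel) \<noteq> 0" for x
  proof -
    have "(\<integral>\<^sup>+ y. indicator {w. c < G x w} y \<partial>lborel) = 0 \<longleftrightarrow> (AE y in lborel. G x y \<le> c)"
      by (subst nn_integral_0_iff_AE) (auto simp: indicator_def not_less)
    also have "\<dots> \<longleftrightarrow> esssup lborel (G x) \<le> c"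
    proof
      assume le: "esssup lborel (G x) \<le> c"
      show "AE y in lborel. G x y \<le> c"
        using esssup_AE[where M=lborel and f="G x"] by eventually_elim (rule order_trans[OF _ le])
    qed (rule esssup_I, simp)
    finally show ?thesis by (simp add: not_le)
  qed
  have "Measurable.pred (borel \<Otimes>\<^sub>M lborel) (\<lambda>w. c < G (fst w) (snd w))"
    by measurable
  then have [measurable]: "(\<lambda>(x, y). indicator {w. c < G x w} y :: ennreal) \<in> borel_measurable (borel \<Otimes>\<^sub>M lborel)"
    by (simp add: indicator_def case_prod_beta)
  show "{x \<in> space borel. c < esssup lborel (G x)} \<in> sets borel"
    unfolding eq by measurable
qed

context centered_gaussian begin

text \<open>
Averages converge back almost everywhere, distribution functions are bounded, and the means stay in
\<open>(0, 1)\<close>, where the inverse is continuous.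
\<close>

lemma ehrhard_ineq_avg_limit:
  assumes u: "bounded_borel u" and v: "bounded_borel v" and r: "bounded_borel r"
    and avg: "\<And>h. h > 0 \<Longrightarrow> ehrhard_ineq (avg h u) v (avg h r)"
  shows "ehrhard_ineq u v r"
proof -
  define e where "e n = inverse (real (Suc n))" for n
  have e: "e n > 0" "e \<longlonglongrightarrow> 0" for n
    unfolding e_def by (simp, rule LIMSEQ_inverse_real_of_nat)
  have lim: "(\<lambda>n. Q (\<integral>x. cdf \<mu> (avg (e n) w x) \<partial>\<mu>)) \<longlonglongrightarrow> Q (\<integral>x. cdf \<mu> (w x) \<partial>\<mu>)"
    if w: "bounded_borel w" for w
  proof -
    have [measurable]: "w \<in> borel_measurable borel" "avg (e n) w \<in> borel_measurable borel" for n
      using w bounded_borel_avg(1)[OF e(1) w] by (auto simp: bounded_borel_def)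
    have "(\<lambda>n. \<integral>x. cdf \<mu> (avg (e n) w x) \<partial>\<mu>) \<longlonglongrightarrow> (\<integral>x. cdf \<mu> (w x) \<partial>\<mu>)"
    proof (rule integral_dominated_convergence[where w="\<lambda>_. 1"])
      have "AE x in \<mu>. (\<lambda>n. avg (e n) w x) \<longlonglongrightarrow> w x"
        unfolding AE_mu_iff by (rule avg_tendsto_AE[OF w e])
      then show "AE x in \<mu>. (\<lambda>n. cdf \<mu> (avg (e n) w x)) \<longlonglongrightarrow> cdf \<mu> (w x)"
        by (rule AE_mp) (intro AE_I2 impI isCont_tendsto_compose[OF DERIV_isCont[OF DERIV_cdf]])
      show "AE x in \<mu>. norm (cdf \<mu> (avg (e n) w x)) \<le> 1" for n
        by (simp add: cdf_nonneg cdf_bounded_prob)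
      show "(\<lambda>x. cdf \<mu> (w x)) \<in> borel_measurable \<mu>" "(\<lambda>x. cdf \<mu> (avg (e n) w x)) \<in> borel_measurable \<mu>" for n
        by measurable
    qed simp
    moreover have "isCont Q (\<integral>x. cdf \<mu> (w x) \<partial>\<mu>)"
      by (rule DERIV_isCont[OF DERIV_Q]) (rule mean_cdf_in_01, measurable)+
    ultimately show ?thesis by (rule isCont_tendsto_compose[rotated])
  qed
  show ?thesis unfolding ehrhard_ineq_def
    by (rule LIMSEQ_le[OF tendsto_add[OF lim[OF u] tendsto_const] lim[OF r]])
       (use avg[OF e(1)] in \<open>auto simp: ehrhard_ineq_def\<close>)
qed

lemma ehrhard_ineq_commute: "ehrhard_ineq u v r \<Longrightarrow> ehrhard_ineq v u r"
  by (simp add: ehrhard_ineq_def add.commute)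

lemma ehrhard_ineq_less_smooth_left:
  assumes IH: "\<And>u r. smooth (Suc k) u \<Longrightarrow> smooth (Suc k) r \<Longrightarrow> ae_sum_le u v r \<Longrightarrow> ehrhard_ineq u v r"
    and v: "bounded_borel v" and u: "smooth k u" and r: "smooth k r" and le: "ae_sum_le u v r"
  shows "ehrhard_ineq u v r"
proof -
  note b = smooth_bounded_borel[OF u] v smooth_bounded_borel[OF r]
  show ?thesis
    by (rule ehrhard_ineq_avg_limit[OF b])
       (intro IH smooth_avg u r ae_sum_le_avg b le)
qed

lemma ehrhard_ineq_less_smooth_right:
  assumes IH: "\<And>u v r. bounded_borel u \<Longrightarrow> smooth (Suc k) v \<Longrightarrow> bounded_borel r \<Longrightarrow>
      ae_sum_le u v r \<Longrightarrow> ehrhard_ineq u v r"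
    and u: "bounded_borel u" and v: "smooth k v" and r: "bounded_borel r" and le: "ae_sum_le u v r"
  shows "ehrhard_ineq u v r"
proof -
  have bv: "bounded_borel v" by (rule smooth_bounded_borel[OF v])
  have le': "ae_sum_le v u r" by (rule ae_sum_le_commute[OF bounded_borelD[OF u] bounded_borelD[OF bv] le])
  have "ehrhard_ineq (avg h v) u (avg h r)" if h: "h > 0" for h
  proof (rule ehrhard_ineq_commute, rule IH)
    have b: "bounded_borel (avg h v)" "bounded_borel (avg h r)"
      by (rule bounded_borel_avg[OF h bv], rule bounded_borel_avg[OF h r])
    show "ae_sum_le u (avg h v) (avg h r)"
      by (rule ae_sum_le_commute[OF bounded_borelD[OF b(1)] bounded_borelD[OF u]
            ae_sum_le_avg[OF h bv u r le']])
    show "bounded_borel (avg h r)" by (rule b)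
  qed (fact u smooth_avg[OF h v])+
  then show ?thesis using ehrhard_ineq_avg_limit[OF bv u r] ehrhard_ineq_commute by blast
qed

text \<open>
Starting from class \<open>3\<close> for all three profiles, the regularity of \<open>u\<close> (together with \<open>r\<close>) is lowered
step by step, and then the regularity of \<open>v\<close>. In each step the profile being lowered is averaged
and \<open>r\<close> is averaged over the same window, so that the previous step applies.
\<close>

lemma ehrhard_ineq_bounded_borel:
  assumes u: "bounded_borel u" and v: "bounded_borel v" and r: "bounded_borel r"
    and le: "ae_sum_le u v r"
  shows "ehrhard_ineq u v r"
proof -
  have left: "ehrhard_ineq u v r"
    if "smooth k u" "smooth (Suc (Suc (Suc 0))) v" "smooth k r" "ae_sum_le u v r" "k \<le> Suc (Suc (Suc 0))"
    for k u v r
    using that(5,1-4)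
  proof (induction k arbitrary: u r rule: inc_induct)
    case base
    then show ?case by (intro ehrhard_ineq_smooth)
  next
    case (step k)
    show ?case
      by (rule ehrhard_ineq_less_smooth_left[OF _ smooth_bounded_borel[OF step.prems(2)]])
         (use step in auto)
  qed
  have right: "ehrhard_ineq u v r"
    if "bounded_borel u" "smooth k v" "bounded_borel r" "ae_sum_le u v r" "k \<le> Suc (Suc (Suc 0))"
    for k u v r
    using that(5,1-4)
  proof (induction k arbitrary: u v r rule: inc_induct)
    case base
    then show ?case using left[of 0] by simp
  next
    case (step k)
    show ?case
      by (rule ehrhard_ineq_less_smooth_right[OF step.IH step.prems])
  qed
  show ?thesis using right[of u 0] u v r le by simp
qed

text \<open>
Truncation of a probability. The lower cut \<open>\<Phi> (- 2 * M)\<close> lies much further out than the upper cut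
\<open>\<Phi> M\<close>: if one of two profiles sits at the lower cut \<open>- 2 * M\<close>, the sum of the two is still at most
\<open>- M\<close>, so raising values to the lower cut changes the combined value by at most \<open>\<Phi> (- M)\<close>.
\<close>

definition trunc :: "real \<Rightarrow> real \<Rightarrow> real" where
  "trunc M t = max (cdf \<mu> (- 2 * M)) (min (cdf \<mu> M) t)"

lemma trunc_bounds:
  assumes "M > 0"
  shows "cdf \<mu> (- 2 * M) \<le> trunc M t" "trunc M t \<le> cdf \<mu> M" "0 < trunc M t" "trunc M t < 1"
proof -
  have "cdf \<mu> (- 2 * M) < cdf \<mu> M" using assms by simp
  then show "cdf \<mu> (- 2 * M) \<le> trunc M t" "trunc M t \<le> cdf \<mu> M" "0 < trunc M t" "trunc M t < 1"
    using cdf_pos[of "-2*M"] cdf_less_1[of M] cdf_less_1[of "-2*M"] by (auto simp: trunc_def)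
qed

lemma Q_trunc_bounds:
  assumes "M > 0" shows "- 2 * M \<le> Q (trunc M t)" "Q (trunc M t) \<le> M"
  using trunc_bounds[OF assms, of t] by (simp_all add: Q_le_iff le_Q_iff)

lemma borel_Q_trunc:
  assumes "M > 0" shows "(\<lambda>t. Q (trunc M t)) \<in> borel_measurable borel"
proof (rule borel_measurable_continuous_onI)
  have "continuous_on UNIV (trunc M)"
    unfolding trunc_def by (intro continuous_intros)
  then show "continuous_on UNIV (\<lambda>t. Q (trunc M t))"
    by (rule continuous_on_compose2[OF continuous_Q]) (use trunc_bounds(3,4)[OF assms] in auto)
qed

lemma cdf_add_le_H:
  assumes M: "M > 0" and p: "0 \<le> p" "p \<le> 1" and q: "0 \<le> q" "q \<le> 1"
  shows "cdf \<mu> (Q (trunc M p) + Q (trunc M q)) \<le> H \<mu> 1 1 p q + cdf \<mu> (- M)"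
proof -
  have Hnn: "0 \<le> H \<mu> 1 1 p q"
    by (auto simp: H_def Phi_def cdf_nonneg split: ereal.split)
  have low: "Q (trunc M t) = - 2 * M" if "t \<le> cdf \<mu> (- 2 * M)" for t
  proof -
    have "trunc M t = cdf \<mu> (- 2 * M)"
      using that trunc_bounds(1,2)[OF M, of t] by (auto simp: trunc_def)
    then show ?thesis by simp
  qed
  have high: "Q (trunc M t) \<le> Q t" if "cdf \<mu> (- 2 * M) < t" "t < 1" for t
    using that trunc_bounds[OF M, of t] by (intro Q_mono) (auto simp: trunc_def)
  consider "p \<le> cdf \<mu> (- 2 * M) \<or> q \<le> cdf \<mu> (- 2 * M)"
    | "cdf \<mu> (- 2 * M) < p" "p < 1" "cdf \<mu> (- 2 * M) < q" "q < 1"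
    | "cdf \<mu> (- 2 * M) < p" "cdf \<mu> (- 2 * M) < q" "p = 1 \<or> q = 1"
    using p q by linarith
  then show ?thesis
  proof cases
    case 1
    then have "Q (trunc M p) + Q (trunc M q) \<le> - M" using low Q_trunc_bounds(2)[OF M, of p] Q_trunc_bounds(2)[OF M, of q] by auto
    then show ?thesis using Hnn by (simp add: add_increasing)
  next
    case 2
    have "H \<mu> 1 1 p q = cdf \<mu> (Q p + Q q)"
      using 2 cdf_pos[of "- 2 * M"] by (subst H_interior) auto
    moreover have "cdf \<mu> (Q (trunc M p) + Q (trunc M q)) \<le> cdf \<mu> (Q p + Q q)"
      using high 2 by (simp add: add_mono)
    ultimately show ?thesis using cdf_nonneg[of "- M"] by linarith
  next
    case 3
    have "p > 0" "q > 0" using 3 cdf_pos[of "- 2 * M"] by auto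
    then have "H \<mu> 1 1 p q = 1"
      using 3(3) p q by (auto simp: H_def Phi_inv_def Phi_def one_ereal_def)
    then show ?thesis
      using cdf_bounded_prob[of "Q (trunc M p) + Q (trunc M q)"] cdf_nonneg[of "- M"] by simp
  qed
qed


text \<open>
The smallest admissible \<open>r\<close> for the truncated profiles is the image under \<open>Q\<close> of the essential
supremum of \<open>\<Phi> (u (x - y) + v y)\<close>. By \<open>cdf_add_le_H\<close> that supremum exceeds the one in the statement by at
most \<open>\<Phi> (- M)\<close>.
\<close>

lemma truncated_functional_ehrhard:
  assumes M: "M > 0"
    and f[measurable]: "f \<in> borel_measurable borel" and g[measurable]: "g \<in> borel_measurable borel"
    and f01: "\<And>x. 0 \<le> f x \<and> f x \<le> 1" and g01: "\<And>x. 0 \<le> g x \<and> g x \<le> 1"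
  shows "ennreal (cdf \<mu> (Q (\<integral>x. trunc M (f x) \<partial>\<mu>) + Q (\<integral>x. trunc M (g x) \<partial>\<mu>)) - cdf \<mu> (- M))
      \<le> (\<integral>\<^sup>+ x. esssup lborel (\<lambda>y. ennreal (H \<mu> 1 1 (f (x - y)) (g y))) \<partial>\<mu>)"
proof -
  note [measurable] = borel_Q_trunc[OF M]
  define u where "u x = Q (trunc M (f x))" for x
  define v where "v x = Q (trunc M (g x))" for x
  define h where "h x = esssup lborel (\<lambda>y. ennreal (H \<mu> 1 1 (f (x - y)) (g y)))" for x
  define k where "k x = esssup lborel (\<lambda>y. ennreal (cdf \<mu> (u (x - y) + v y)))" for x
  have uv[measurable]: "u \<in> borel_measurable borel" "v \<in> borel_measurable borel"
    unfolding u_def v_def by measurable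
  have ub: "- 2 * M \<le> u x" "u x \<le> M" "- 2 * M \<le> v x" "v x \<le> M" for x
    unfolding u_def v_def by (rule Q_trunc_bounds[OF M])+
  have [measurable]: "k \<in> borel_measurable borel"
    unfolding k_def by (rule borel_measurable_esssup) measurable
  have k_AE: "AE y in lborel. ennreal (cdf \<mu> (u (x - y) + v y)) \<le> k x" for x
    unfolding k_def by (rule esssup_AE)
  have k_up: "k x \<le> ennreal (cdf \<mu> (4 * M))" for x
    unfolding k_def
  proof (rule esssup_I)
    show "AE y in lborel. ennreal (cdf \<mu> (u (x - y) + v y)) \<le> ennreal (cdf \<mu> (4 * M))"
    proof (intro AE_I2 ennreal_leI)
      fix y show "cdf \<mu> (u (x - y) + v y) \<le> cdf \<mu> (4 * M)"
        using ub(2)[of "x - y"] ub(4)[of y] M by simp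
    qed
  qed measurable
  have k_low: "ennreal (cdf \<mu> (- 4 * M)) \<le> k x" for x
  proof -
    have "\<exists>y. ennreal (cdf \<mu> (u (x - y) + v y)) \<le> k x"
    proof (rule ccontr)
      assume "\<not> ?thesis"
      with k_AE[of x] have "AE y::real in lborel. False" by simp
      then show False by (simp add: AE_iff_measurable[of UNIV])
    qed
    then obtain y where y: "ennreal (cdf \<mu> (u (x - y) + v y)) \<le> k x" by blast
    have "cdf \<mu> (- 4 * M) \<le> cdf \<mu> (u (x - y) + v y)" using ub(1)[of "x - y"] ub(3)[of y] by simp
    then show ?thesis using y ennreal_leI order_trans by blast
  qed
  define \<kappa> where "\<kappa> x = enn2real (k x)" for x
  have k\<kappa>: "k x = ennreal (\<kappa> x)" for x
    using k_up[of x] unfolding \<kappa>_def by (simp add: ennreal_enn2real_if top_unique split: if_splits) (metis ennreal_neq_top top_unique)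
  have \<kappa>0: "0 \<le> \<kappa> x" for x by (simp add: \<kappa>_def)
  have \<kappa>: "cdf \<mu> (- 4 * M) \<le> \<kappa> x" "\<kappa> x \<le> cdf \<mu> (4 * M)" for x
    using k_low[of x] k_up[of x] \<kappa>0[of x] cdf_nonneg[of "4 * M"] unfolding k\<kappa> by simp_all
  have \<kappa>01: "0 < \<kappa> x" "\<kappa> x < 1" for x
    using \<kappa>[of x] cdf_pos[of "-4*M"] cdf_less_1[of "4*M"] by linarith+
  have [measurable]: "\<kappa> \<in> borel_measurable borel" unfolding \<kappa>_def by measurable
  define r where "r x = Q (\<kappa> x)" for x
  have cr: "cdf \<mu> (r x) = \<kappa> x" for x using \<kappa>01 by (simp add: r_def)
  have rb: "\<bar>r x\<bar> \<le> 4 * M" for x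
  proof -
    have "- 4 * M \<le> r x" "r x \<le> 4 * M"
      using \<kappa>[of x] \<kappa>01[of x] by (simp_all add: r_def Q_le_iff le_Q_iff)
    then show ?thesis by simp
  qed
  have [measurable]: "r \<in> borel_measurable borel"
  proof -
    have "(\<lambda>t. Q (trunc (4 * M) t)) \<in> borel_measurable borel" by (rule borel_Q_trunc) (use M in simp)
    then have "(\<lambda>x. Q (trunc (4 * M) (\<kappa> x))) \<in> borel_measurable borel" by measurable
    moreover have "trunc (4 * M) (\<kappa> x) = \<kappa> x" for x
    proof -
      have "cdf \<mu> (- 2 * (4 * M)) \<le> cdf \<mu> (- 4 * M)" using M by simp
      then have "cdf \<mu> (- 2 * (4 * M)) \<le> \<kappa> x" using \<kappa>(1) order_trans by blast
      then show ?thesis using \<kappa>(2)[of x] by (simp add: trunc_def)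
    qed
    ultimately show ?thesis by (simp add: r_def[abs_def])
  qed
  have "ehrhard_ineq u v r"
  proof (rule ehrhard_ineq_bounded_borel)
    have "\<bar>u x\<bar> \<le> 2 * M" "\<bar>v x\<bar> \<le> 2 * M" for x using ub[of x] M by auto
    then show "bounded_borel u" "bounded_borel v" using uv unfolding bounded_borel_def by blast+
    show "bounded_borel r" unfolding bounded_borel_def using rb by auto
    show "ae_sum_le u v r" unfolding ae_sum_le_def
    proof
      fix z
      show "AE y in lborel. u (z - y) + v y \<le> r z"
        using k_AE[of z]
      proof (rule AE_mp, intro AE_I2 impI)
        fix y assume "ennreal (cdf \<mu> (u (z - y) + v y)) \<le> k z"
        then have "cdf \<mu> (u (z - y) + v y) \<le> cdf \<mu> (r z)"
          using \<kappa>0[of z] unfolding k\<kappa> cr by (simp add: cdf_nonneg)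
        then show "u (z - y) + v y \<le> r z" by simp
      qed
    qed
  qed
  moreover have "cdf \<mu> (u x) = trunc M (f x)" "cdf \<mu> (v x) = trunc M (g x)" for x
    unfolding u_def v_def using trunc_bounds(3,4)[OF M] by simp_all
  ultimately have "Q (\<integral>x. trunc M (f x) \<partial>\<mu>) + Q (\<integral>x. trunc M (g x) \<partial>\<mu>) \<le> Q (\<integral>x. \<kappa> x \<partial>\<mu>)"
    by (simp add: ehrhard_ineq_def cr)
  moreover have i\<kappa>: "integrable \<mu> \<kappa>"
    by (rule integrable_bounded[where B=1]) (use \<kappa>01 in \<open>auto simp: less_imp_le abs_le_iff intro: order_trans[of _ 0]\<close>)
  moreover have "0 < (\<integral>x. \<kappa> x \<partial>\<mu>)" "(\<integral>x. \<kappa> x \<partial>\<mu>) < 1"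
    using expectation_greater[OF i\<kappa>, of 0] expectation_less[OF i\<kappa>, of 1] \<kappa>01 by auto
  ultimately have main: "cdf \<mu> (Q (\<integral>x. trunc M (f x) \<partial>\<mu>) + Q (\<integral>x. trunc M (g x) \<partial>\<mu>)) \<le> (\<integral>x. \<kappa> x \<partial>\<mu>)"
    by (simp add: le_Q_iff)
  \<comment> \<open>subtracting \<open>\<epsilon>\<close> from \<open>\<kappa>\<close> rather than adding it to \<open>h\<close> keeps the left-hand side Borel; \<open>h\<close> itself enters only through monotonicity\<close>
  define \<epsilon> where "\<epsilon> = cdf \<mu> (- M)"
  have \<epsilon>: "\<epsilon> \<ge> 0" by (simp add: \<epsilon>_def cdf_nonneg)
  have \<kappa>h: "ennreal (max 0 (\<kappa> x - \<epsilon>)) \<le> h x" for x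
  proof -
    have "AE y in lborel. ennreal (H \<mu> 1 1 (f (x - y)) (g y)) \<le> h x"
      unfolding h_def by (rule esssup_AE)
    then have "AE y in lborel. ennreal (cdf \<mu> (u (x - y) + v y)) \<le> h x + ennreal \<epsilon>"
    proof (rule AE_mp, intro AE_I2 impI)
      fix y assume y: "ennreal (H \<mu> 1 1 (f (x - y)) (g y)) \<le> h x"
      have "cdf \<mu> (u (x - y) + v y) \<le> H \<mu> 1 1 (f (x - y)) (g y) + \<epsilon>"
        unfolding u_def v_def \<epsilon>_def using f01 g01 by (intro cdf_add_le_H[OF M]) auto
      then have "ennreal (cdf \<mu> (u (x - y) + v y)) \<le> ennreal (H \<mu> 1 1 (f (x - y)) (g y) + \<epsilon>)"
        by (rule ennreal_leI)
      also have "\<dots> \<le> ennreal (H \<mu> 1 1 (f (x - y)) (g y)) + ennreal \<epsilon>"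
        by (cases "H \<mu> 1 1 (f (x - y)) (g y) \<ge> 0") (use \<epsilon> in \<open>auto simp: ennreal_plus ennreal_neg intro!: ennreal_leI\<close>)
      also have "\<dots> \<le> h x + ennreal \<epsilon>" using y by (rule add_right_mono)
      finally show "ennreal (cdf \<mu> (u (x - y) + v y)) \<le> h x + ennreal \<epsilon>" .
    qed
    then have "k x \<le> h x + ennreal \<epsilon>"
      unfolding k_def by (intro esssup_I) measurable
    then have le: "ennreal (\<kappa> x) \<le> h x + ennreal \<epsilon>" by (simp add: k\<kappa>)
    show ?thesis
    proof (cases "h x")
      case (real t)
      then have "ennreal (\<kappa> x) \<le> ennreal (t + \<epsilon>)" using le \<epsilon> by (simp add: ennreal_plus)
      then have "\<kappa> x \<le> t + \<epsilon>" using real(1) \<epsilon> by (subst (asm) ennreal_le_iff) auto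
      then show ?thesis using real by (simp add: ennreal_leI)
    qed simp
  qed
  have im: "integrable \<mu> (\<lambda>x. max 0 (\<kappa> x - \<epsilon>))" using i\<kappa> by auto
  have "cdf \<mu> (Q (\<integral>x. trunc M (f x) \<partial>\<mu>) + Q (\<integral>x. trunc M (g x) \<partial>\<mu>)) - \<epsilon> \<le> (\<integral>x. \<kappa> x - \<epsilon> \<partial>\<mu>)"
    using main i\<kappa> prob_space by simp
  also have "\<dots> \<le> (\<integral>x. max 0 (\<kappa> x - \<epsilon>) \<partial>\<mu>)"
    by (rule integral_mono) (use i\<kappa> im in auto)
  finally have "ennreal (cdf \<mu> (Q (\<integral>x. trunc M (f x) \<partial>\<mu>) + Q (\<integral>x. trunc M (g x) \<partial>\<mu>)) - \<epsilon>)
      \<le> ennreal (\<integral>x. max 0 (\<kappa> x - \<epsilon>) \<partial>\<mu>)" by (rule ennreal_leI)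
  also have "\<dots> = (\<integral>\<^sup>+ x. ennreal (max 0 (\<kappa> x - \<epsilon>)) \<partial>\<mu>)"
    by (rule nn_integral_eq_integral[symmetric]) (use im in auto)
  also have "\<dots> \<le> (\<integral>\<^sup>+ x. h x \<partial>\<mu>)" by (intro nn_integral_mono \<kappa>h)
  finally show ?thesis unfolding h_def \<epsilon>_def .
qed

text \<open>
Removing the truncation. Since \<open>f \<le> 1\<close>, the truncated mean is at least \<open>\<Phi> M\<close> times the mean of \<open>f\<close>, so
it suffices to let \<open>M\<close> tend to infinity in \<open>\<Phi> (Q (\<Phi> M * p) + Q (\<Phi> M * q))\<close>. If \<open>p\<close> or \<open>q\<close> is \<open>0\<close>, then
\<open>H\<close> vanishes by its conventions.
\<close>

lemma functional_ehrhard: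
  assumes f[measurable]: "f \<in> borel_measurable borel" and g[measurable]: "g \<in> borel_measurable borel"
    and f01: "\<And>x. 0 \<le> f x \<and> f x \<le> 1" and g01: "\<And>x. 0 \<le> g x \<and> g x \<le> 1"
  shows "ennreal (H \<mu> 1 1 (\<integral>x. f x \<partial>\<mu>) (\<integral>x. g x \<partial>\<mu>))
      \<le> (\<integral>\<^sup>+ x. esssup lborel (\<lambda>y. ennreal (H \<mu> 1 1 (f (x - y)) (g y))) \<partial>\<mu>)" (is "_ \<le> ?I")
proof -
  define p where "p = (\<integral>x. f x \<partial>\<mu>)"
  define q where "q = (\<integral>x. g x \<partial>\<mu>)"
  have int: "integrable \<mu> w" if "w \<in> borel_measurable borel" "\<And>x. 0 \<le> w x \<and> w x \<le> 1" for w :: "real \<Rightarrow> real"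
  proof (rule integrable_bounded[OF that(1)])
    show "\<bar>w x\<bar> \<le> 1" for x using that(2)[of x] by auto
  qed
  have pq: "0 \<le> p" "p \<le> 1" "0 \<le> q" "q \<le> 1"
    unfolding p_def q_def using int[OF f f01] int[OF g g01] f01 g01
    by (auto intro!: integral_ge_const integral_le_const)
  define m where "m n = cdf \<mu> (real n)" for n
  have m: "0 < m n" "m n < 1" for n by (simp_all add: m_def cdf_pos cdf_less_1)
  have m1: "m \<longlonglongrightarrow> 1" unfolding m_def by (rule cdf_lim_infty_prob)
  have mean: "m n * (\<integral>x. w x \<partial>\<mu>) \<le> (\<integral>x. trunc (real n) (w x) \<partial>\<mu>)" "(\<integral>x. trunc (real n) (w x) \<partial>\<mu>) < 1"
    if w[measurable]: "w \<in> borel_measurable borel" and w01: "\<And>x. 0 \<le> w x \<and> w x \<le> 1" and n: "n > 0" for w n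
  proof -
    have n': "real n > 0" using n by simp
    have tm[measurable]: "(\<lambda>x. trunc (real n) (w x)) \<in> borel_measurable borel"
      unfolding trunc_def by measurable
    have i: "integrable \<mu> (\<lambda>x. trunc (real n) (w x))"
      by (rule int[OF tm]) (use trunc_bounds(3,4)[OF n'] in \<open>auto intro: less_imp_le\<close>)
    have "m n * (\<integral>x. w x \<partial>\<mu>) = (\<integral>x. m n * w x \<partial>\<mu>)" by simp
    also have "\<dots> \<le> (\<integral>x. trunc (real n) (w x) \<partial>\<mu>)"
    proof (rule integral_mono)
      show "integrable \<mu> (\<lambda>x. m n * w x)" using int[OF w w01] by simp
      fix x
      have "m n * w x \<le> m n * 1" "m n * w x \<le> 1 * w x"
        by (rule mult_left_mono, use m[of n] w01[of x] in auto)
           (rule mult_left_le_one_le, use m[of n] w01[of x] in auto)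
      then have "m n * w x \<le> min (cdf \<mu> (real n)) (w x)" by (simp add: m_def)
      also have "\<dots> \<le> trunc (real n) (w x)" by (simp add: trunc_def)
      finally show "m n * w x \<le> trunc (real n) (w x)" .
    qed (rule i)
    finally show "m n * (\<integral>x. w x \<partial>\<mu>) \<le> (\<integral>x. trunc (real n) (w x) \<partial>\<mu>)" .
    show "(\<integral>x. trunc (real n) (w x) \<partial>\<mu>) < 1"
      by (rule expectation_less[OF i]) (use trunc_bounds(4)[OF n'] in auto)
  qed
  consider "p = 0 \<or> q = 0" | "0 < p" "0 < q" using pq by linarith
  then show ?thesis
  proof cases
    case 1
    then have "H \<mu> 1 1 p q = 0"
      using pq by (auto simp: H_def Phi_inv_def Phi_def one_ereal_def)
    then show ?thesis by (simp add: p_def q_def)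
  next
    case 2
    have mt: "0 < m n * t" "m n * t < 1" if "0 < t" "t \<le> 1" for n t
    proof -
      have "m n * t \<le> m n" by (rule mult_left_le) (use m[of n] that in simp_all)
      then show "m n * t < 1" using m(2)[of n] by linarith
      show "0 < m n * t" using m(1)[of n] that(1) by (rule mult_pos_pos)
    qed
    note mp = mt[OF 2(1) pq(2)] mt[OF 2(2) pq(4)]
    define a where "a n = cdf \<mu> (Q (m n * p) + Q (m n * q)) - cdf \<mu> (- real n)" for n
    have le: "ennreal (a n) \<le> ?I" if n: "n > 0" for n
    proof -
      have n': "real n > 0" using n by simp
      have "Q (m n * p) \<le> Q (\<integral>x. trunc (real n) (f x) \<partial>\<mu>)"
        by (rule Q_mono[OF mp(1)]) (use mean[OF f f01 n] in \<open>simp_all add: p_def\<close>)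
      moreover have "Q (m n * q) \<le> Q (\<integral>x. trunc (real n) (g x) \<partial>\<mu>)"
        by (rule Q_mono[OF mp(3)]) (use mean[OF g g01 n] in \<open>simp_all add: q_def\<close>)
      ultimately have "a n \<le> cdf \<mu> (Q (\<integral>x. trunc (real n) (f x) \<partial>\<mu>) + Q (\<integral>x. trunc (real n) (g x) \<partial>\<mu>)) - cdf \<mu> (- real n)"
        unfolding a_def by (simp add: add_mono)
      then have "ennreal (a n) \<le> ennreal (cdf \<mu> (Q (\<integral>x. trunc (real n) (f x) \<partial>\<mu>) + Q (\<integral>x. trunc (real n) (g x) \<partial>\<mu>)) - cdf \<mu> (- real n))"
        by (rule ennreal_leI)
      also have "\<dots> \<le> ?I" by (rule truncated_functional_ehrhard[OF n' f g f01 g01])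
      finally show ?thesis .
    qed
    \<comment> \<open>if one mean is \<open>1\<close>, its truncated inverse is exactly \<open>n\<close> and drives the sum to infinity\<close>
    have one: "(\<lambda>n. cdf \<mu> (Q (m n * 1) + Q (m n * t))) \<longlonglongrightarrow> 1" if t: "0 < t" "t \<le> 1" for t
    proof (rule tendsto_sandwich[OF _ _ _ tendsto_const])
      show "\<forall>\<^sub>F n in sequentially. cdf \<mu> (real n + Q (m 0 * t)) \<le> cdf \<mu> (Q (m n * 1) + Q (m n * t))"
      proof (rule always_eventually, rule allI)
        fix n
        have "m 0 * t \<le> m n * t" using t by (simp add: m_def)
        then have "Q (m 0 * t) \<le> Q (m n * t)" by (intro Q_mono mt t)
        then show "cdf \<mu> (real n + Q (m 0 * t)) \<le> cdf \<mu> (Q (m n * 1) + Q (m n * t))"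
          by (simp add: m_def)
      qed
      have "filterlim (\<lambda>n. Q (m 0 * t) + real n) at_top sequentially"
        by (rule filterlim_tendsto_add_at_top[OF tendsto_const filterlim_real_sequentially])
      then show "(\<lambda>n. cdf \<mu> (real n + Q (m 0 * t))) \<longlonglongrightarrow> 1"
        using filterlim_compose[OF cdf_lim_at_top_prob] by (simp add: add.commute)
    qed (simp add: cdf_bounded_prob)
    have "(\<lambda>n. cdf \<mu> (Q (m n * p) + Q (m n * q))) \<longlonglongrightarrow> H \<mu> 1 1 p q"
    proof (cases "p = 1 \<or> q = 1")
      case True
      then have "H \<mu> 1 1 p q = 1"
        using 2 by (auto simp: H_def Phi_inv_def Phi_def one_ereal_def)
      moreover have "(\<lambda>n. cdf \<mu> (Q (m n * p) + Q (m n * q))) \<longlonglongrightarrow> 1"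
        using True
      proof
        assume "p = 1" then show ?thesis using one[OF 2(2) pq(4)] by simp
      next
        assume "q = 1"
        then have "cdf \<mu> (Q (m n * p) + Q (m n * q)) = cdf \<mu> (Q (m n * 1) + Q (m n * p))" for n
          by (simp only: add.commute)
        with one[OF 2(1) pq(2)] show ?thesis by (simp only:)
      qed
      ultimately show ?thesis by simp
    next
      case False
      then have lt: "p < 1" "q < 1" using pq by auto
      have "(\<lambda>n. Q (m n * t)) \<longlonglongrightarrow> Q (1 * t)" if t: "0 < t" "t < 1" for t
      proof (rule isCont_tendsto_compose[where g=Q])
        show "isCont Q (1 * t)" by (rule DERIV_isCont[OF DERIV_Q]) (use t in simp_all)
        show "(\<lambda>n. m n * t) \<longlonglongrightarrow> 1 * t" by (rule tendsto_mult_right[OF m1])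
      qed
      from tendsto_add[OF this[OF 2(1) lt(1)] this[OF 2(2) lt(2)]]
      have "(\<lambda>n. cdf \<mu> (Q (m n * p) + Q (m n * q))) \<longlonglongrightarrow> cdf \<mu> (Q (1 * p) + Q (1 * q))"
        by (rule isCont_tendsto_compose[where g="cdf \<mu>", OF DERIV_isCont[OF DERIV_cdf]])
      then show ?thesis using 2 lt by (simp add: H_interior)
    qed
    from tendsto_diff[OF this cdf_lim_neg_infty] have "a \<longlonglongrightarrow> H \<mu> 1 1 p q" by (simp add: a_def[abs_def])
    then have "(\<lambda>n. ennreal (a n)) \<longlonglongrightarrow> ennreal (H \<mu> 1 1 p q)" by (rule tendsto_ennrealI)
    then have "ennreal (H \<mu> 1 1 p q) \<le> ?I"
    proof (rule LIMSEQ_le_const2)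
      have "\<forall>n\<ge>1. ennreal (a n) \<le> ?I" using le by simp
      then show "\<exists>N. \<forall>n\<ge>N. ennreal (a n) \<le> ?I" by blast
    qed
    then show ?thesis by (simp add: p_def q_def)
  qed
qed

end


section \<open>The characterization\<close>

theorem corollary4:
  fixes \<mu> :: "real measure" and V :: "real \<Rightarrow> real"
  assumes "prob_space \<mu>"
    and "even_measure \<mu>"
    and "integrable \<mu> (\<lambda>x. \<bar>x\<bar> ^ 5)"
    and "\<mu> = density lborel (\<lambda>x. ennreal (exp (- V x)))"
    and "C2 V"
  shows "(\<exists>a b :: real. a > 0 \<and> b > 0 \<and>
           (\<forall>f g :: real \<Rightarrow> real.
              f \<in> borel_measurable borel \<longrightarrow> g \<in> borel_measurable borel \<longrightarrow>
              (\<forall>x. 0 \<le> f x \<and> f x \<le> 1) \<longrightarrow> (\<forall>x. 0 \<le> g x \<and> g x \<le> 1) \<longrightarrow>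
              (\<integral>\<^sup>+ x. esssup lborel (\<lambda>y. ennreal (H \<mu> a b (f ((x - y) / a)) (g (y / b)))) \<partial>\<mu>)
                \<ge> ennreal (H \<mu> a b (\<integral>x. f x \<partial>\<mu>) (\<integral>x. g x \<partial>\<mu>))))
         \<longleftrightarrow> gaussian_measure \<mu>"
    (is "?ineq \<longleftrightarrow> _")
proof -
  obtain V' V'' where V: "\<And>x. DERIV V x :> V' x" "\<And>x. DERIV V' x :> V'' x"
    using assms(5) by (auto simp: C2_def)
  have "continuous_on UNIV V"
    by (auto intro!: continuous_at_imp_continuous_on DERIV_isCont[OF V(1)])
  then have pd: "positive_density \<mu> (\<lambda>x. exp (- V x))"
    using assms(1,4) by (intro positive_density.intro) (auto intro!: continuous_intros)
  then interpret positive_density \<mu> "\<lambda>x. exp (- V x)" .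
  \<comment> \<open>the fifth moment controls the first and the second one\<close>
  have moment: "integrable \<mu> (\<lambda>x. x ^ k)" if k: "k \<le> 5" for k :: nat
  proof (rule Bochner_Integration.integrable_bound[of _ "\<lambda>x. 1 + \<bar>x\<bar> ^ 5"])
    show "integrable \<mu> (\<lambda>x. 1 + \<bar>x\<bar> ^ 5)" using assms(3) by simp
    show "AE x in \<mu>. norm (x ^ k) \<le> norm (1 + \<bar>x\<bar> ^ 5)"
    proof (rule AE_I2)
      fix x :: real
      have "\<bar>x\<bar> ^ k \<le> 1 + \<bar>x\<bar> ^ 5"
      proof (cases "\<bar>x\<bar> \<le> 1")
        case True
        then have "\<bar>x\<bar> ^ k \<le> 1" by (simp add: power_le_one)
        then show ?thesis by (simp add: add_increasing2)
      next
        case False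
        then have "\<bar>x\<bar> ^ k \<le> \<bar>x\<bar> ^ 5" using k by (intro power_increasing) auto
        then show ?thesis by simp
      qed
      then show "norm (x ^ k) \<le> norm (1 + \<bar>x\<bar> ^ 5)" by (simp add: power_abs)
    qed
  qed measurable
  show ?thesis
  proof
    assume ?ineq
    then obtain a b where ab: "a > 0" "b > 0" and ineq: "\<And>f g. f \<in> borel_measurable borel \<Longrightarrow> g \<in> borel_measurable borel \<Longrightarrow>
        (\<forall>x. 0 \<le> f x \<and> f x \<le> 1) \<Longrightarrow> (\<forall>x. 0 \<le> g x \<and> g x \<le> 1) \<Longrightarrow>
        (\<integral>\<^sup>+ x. esssup lborel (\<lambda>y. ennreal (H \<mu> a b (f ((x - y) / a)) (g (y / b)))) \<partial>\<mu>)
          \<ge> ennreal (H \<mu> a b (\<integral>x. f x \<partial>\<mu>) (\<integral>x. g x \<partial>\<mu>))"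
      by blast
    have "integrable \<mu> (\<lambda>x. x\<^sup>2)" by (rule moment) simp
    then show "gaussian_measure \<mu>"
      by (rule gaussian_of_functional_inequality[OF pd assms(2) _ V ab]) (rule ineq)
  next
    assume "gaussian_measure \<mu>"
    then obtain \<alpha> \<beta> c where \<alpha>: "\<alpha> > 0"
      and \<mu>: "\<mu> = density lborel (\<lambda>x. ennreal (exp (- \<alpha> * x\<^sup>2 + \<beta> * x + c)))"
      unfolding gaussian_measure_def by blast
    have pd': "positive_density \<mu> (\<lambda>x. exp (- \<alpha> * x\<^sup>2 + \<beta> * x + c))"
      using assms(1) \<mu> by (intro positive_density.intro) (auto intro!: continuous_intros)
    \<comment> \<open>compare the density at \<open>1\<close> and \<open>- 1\<close>\<close>
    have "\<beta> = 0"
      using positive_density.even_density[OF pd' assms(2), of 1] by simp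
    then have "(\<lambda>x. exp (- \<alpha> * x\<^sup>2 + \<beta> * x + c)) = (\<lambda>x. exp (c - \<alpha> * x\<^sup>2))"
      by (simp add: fun_eq_iff)
    with pd' have pd0: "positive_density \<mu> (\<lambda>x. exp (c - \<alpha> * x\<^sup>2))" by simp
    interpret G: centered_gaussian \<mu> \<alpha> c
      using pd0 \<alpha> moment[of 1] by (intro centered_gaussian.intro centered_gaussian_axioms.intro) simp_all
    show ?ineq
    proof (intro exI[of _ "1 :: real"] conjI allI impI)
      fix f g :: "real \<Rightarrow> real"
      assume "f \<in> borel_measurable borel" "g \<in> borel_measurable borel"
        "\<forall>x. 0 \<le> f x \<and> f x \<le> 1" "\<forall>x. 0 \<le> g x \<and> g x \<le> 1"
      then show "ennreal (H \<mu> 1 1 (\<integral>x. f x \<partial>\<mu>) (\<integral>x. g x \<partial>\<mu>))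
          \<le> (\<integral>\<^sup>+ x. esssup lborel (\<lambda>y. ennreal (H \<mu> 1 1 (f ((x - y) / 1)) (g (y / 1)))) \<partial>\<mu>)"
        using G.functional_ehrhard[of f g] by simp
    qed simp_all
  qed
qed

end
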